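(* Let $n\ge 1$ and $m\geq n+3$ be integers, let $\mathfrak M_{n,m}$ be the coarse moduli space of $m$ ordered hyperplanes in $\mathbb P^n$ in general position, and let $s\in\mathfrak M_{n,m}$. Then the fundamental group $\pi_1(\mathfrak M_{n,m},s)$ is large, that is, there is a homomorphism from $\pi_1(\mathfrak M_{n,m},s)$ to a noncompact semisimple real algebraic group which has Zariski-dense image.
   Context: Hyperplanes $H_1,\dots,H_m$ in $\mathbb P^n$ (over $\mathbb C$) are in general position if no $n+1$ of them meet in a point. $\mathfrak M_{n,m}$ is the quotient of $\{(H_1,\dots,H_m)\in(\hat{\mathbb P}^n)^m : H_1,\dots,H_m\text{ in general position}\}$ by the automorphism group of $\mathbb P^n$, where $\hat{\mathbb P}^n$ is the dual projective space. *)

theory Defs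
  imports
    "HOL-Analysis.Analysis"
    "HOL-Algebra.Solvable_Groups"
    "Jordan_Normal_Form.Matrix"
begin

subsection \<open>Quotient topologies\<close>

definition quotient_topology :: "'a topology \<Rightarrow> ('a \<Rightarrow> 'b) \<Rightarrow> 'b topology" where
  "quotient_topology X f =
     topology (\<lambda>U. U \<subseteq> f ` topspace X \<and> openin X {x \<in> topspace X. f x \<in> U})"

lemma openin_quotient_topology:
  "openin (quotient_topology X f) U \<longleftrightarrow>
     U \<subseteq> f ` topspace X \<and> openin X {x \<in> topspace X. f x \<in> U}"
proof -
  have "istopology (\<lambda>U. U \<subseteq> f ` topspace X \<and> openin X {x \<in> topspace X. f x \<in> U})"
    unfolding istopology_def
  proof (intro conjI allI impI)
    fix S T
    assume "S \<subseteq> f ` topspace X \<and> openin X {x \<in> topspace X. f x \<in> S}"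
      and "T \<subseteq> f ` topspace X \<and> openin X {x \<in> topspace X. f x \<in> T}"
    moreover have "{x \<in> topspace X. f x \<in> S \<inter> T} =
        {x \<in> topspace X. f x \<in> S} \<inter> {x \<in> topspace X. f x \<in> T}"
      by auto
    ultimately show "S \<inter> T \<subseteq> f ` topspace X" "openin X {x \<in> topspace X. f x \<in> S \<inter> T}"
      by auto
  next
    fix K
    assume K: "\<forall>S\<in>K. S \<subseteq> f ` topspace X \<and> openin X {x \<in> topspace X. f x \<in> S}"
    have "{x \<in> topspace X. f x \<in> \<Union>K} = (\<Union>S\<in>K. {x \<in> topspace X. f x \<in> S})"
      by auto
    with K show "openin X {x \<in> topspace X. f x \<in> \<Union>K}"
      by auto
    from K show "\<Union>K \<subseteq> f ` topspace X"
      by auto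
  qed
  then show ?thesis
    by (simp add: quotient_topology_def topology_inverse')
qed

lemma topspace_quotient_topology: "topspace (quotient_topology X f) = f ` topspace X"
proof (rule subset_antisym)
  show "topspace (quotient_topology X f) \<subseteq> f ` topspace X"
    using openin_quotient_topology[of X f "topspace (quotient_topology X f)"] by simp
  have "{x \<in> topspace X. f x \<in> f ` topspace X} = topspace X"
    by auto
  then show "f ` topspace X \<subseteq> topspace (quotient_topology X f)"
    by (intro openin_subset) (simp add: openin_quotient_topology)
qed

lemma quotient_map_quotient_topology: "quotient_map X (quotient_topology X f) f"
  by (auto simp: quotient_map_def topspace_quotient_topology openin_quotient_topology)


subsection \<open>The fundamental group of a topological space\<close>

definition loops :: "'a topology \<Rightarrow> 'a \<Rightarrow> (real \<Rightarrow> 'a) set" where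
  "loops X s = {g. pathin X g \<and> g 0 = s \<and> g 1 = s}"

definition homotopic_loops_at :: "'a topology \<Rightarrow> 'a \<Rightarrow> (real \<Rightarrow> 'a) \<Rightarrow> (real \<Rightarrow> 'a) \<Rightarrow> bool" where
  "homotopic_loops_at X s g h \<longleftrightarrow>
     homotopic_with (\<lambda>k. k 0 = s \<and> k 1 = s) (top_of_set {0..1}) X g h"

text \<open>The library's \<^const>\<open>joinpaths\<close> needs a type of class \<^class>\<open>topological_space\<close>.\<close>

definition concat_loops :: "(real \<Rightarrow> 'a) \<Rightarrow> (real \<Rightarrow> 'a) \<Rightarrow> real \<Rightarrow> 'a" where
  "concat_loops g h = (\<lambda>t. if t \<le> 1/2 then g (2 * t) else h (2 * t - 1))"

definition loop_class :: "'a topology \<Rightarrow> 'a \<Rightarrow> (real \<Rightarrow> 'a) \<Rightarrow> (real \<Rightarrow> 'a) set" where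
  "loop_class X s g = {h \<in> loops X s. homotopic_loops_at X s g h}"

definition fundamental_group :: "'a topology \<Rightarrow> 'a \<Rightarrow> (real \<Rightarrow> 'a) set monoid" where
  "fundamental_group X s =
     \<lparr> carrier = loop_class X s ` loops X s,
       mult = (\<lambda>C D. \<Union>g\<in>C. \<Union>h\<in>D. loop_class X s (concat_loops g h)),
       one = loop_class X s (\<lambda>_. s) \<rparr>"


subsection \<open>Hyperplanes in projective space and their moduli\<close>

text \<open>
  Projective \<open>n\<close>-space is the set of lines through the origin in \<open>complex ^ 'n\<close>, where
  \<open>CARD('n) = n + 1\<close>.
\<close>

definition projective_space :: "(complex ^ 'n::finite) set set" where
  "projective_space = {vec.span {v} | v. v \<noteq> 0}"

definition hyperplane :: "complex ^ 'n::finite \<Rightarrow> (complex ^ 'n) set set" where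
  "hyperplane a = {p \<in> projective_space. \<forall>x\<in>p. (\<Sum>i\<in>UNIV. a $ i * x $ i) = 0}"

text \<open>
  For \<open>a, b \<noteq> 0\<close> the hyperplanes of \<open>a\<close> and \<open>b\<close> agree iff \<open>a\<close> and \<open>b\<close> are proportional, so
  this is the projectivization of the dual vector space.
\<close>

definition dual_projective_space :: "(complex ^ 'n::finite) set set topology" where
  "dual_projective_space = quotient_topology (top_of_set (- {0})) hyperplane"

text \<open>The automorphisms of projective space are the projective linear transformations.\<close>

definition projective_automorphisms ::
    "((complex ^ 'n::finite) set \<Rightarrow> (complex ^ 'n) set) set" where
  "projective_automorphisms = {(\<lambda>p. (*v) A ` p) | A :: complex ^ 'n ^ 'n. invertible A}"

text \<open>
  Indices, rather than hyperplanes, are counted: a hyperplane occurring twice in the tuple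
  counts twice.
\<close>

definition general_position :: "nat \<Rightarrow> (nat \<Rightarrow> (complex ^ 'n::finite) set set) \<Rightarrow> bool" where
  "general_position m H \<longleftrightarrow>
     (\<forall>I \<subseteq> {..<m}. card I = CARD('n) \<longrightarrow> (\<Inter>i\<in>I. H i) = {})"

definition hyperplane_configurations ::
    "nat \<Rightarrow> (nat \<Rightarrow> (complex ^ 'n::finite) set set) topology" where
  "hyperplane_configurations m =
     subtopology (product_topology (\<lambda>_. dual_projective_space) {..<m})
                 {H. general_position m H}"

definition configuration_orbit ::
    "nat \<Rightarrow> (nat \<Rightarrow> (complex ^ 'n::finite) set set) \<Rightarrow> (nat \<Rightarrow> (complex ^ 'n) set set) set" where
  "configuration_orbit m H =
     {(\<lambda>i\<in>{..<m}. \<phi> ` H i) | \<phi>. \<phi> \<in> projective_automorphisms}"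

definition hyperplane_moduli ::
    "nat \<Rightarrow> (nat \<Rightarrow> (complex ^ 'n::finite) set set) set topology" where
  "hyperplane_moduli m = quotient_topology (hyperplane_configurations m) (configuration_orbit m)"


subsection \<open>Real algebraic groups\<close>

definition general_linear_group :: "nat \<Rightarrow> real mat monoid" where
  "general_linear_group N = units_of (ring_mat TYPE(real) N ())"

inductive polynomial_in_entries :: "nat \<Rightarrow> (real mat \<Rightarrow> real) \<Rightarrow> bool" for N where
  const: "polynomial_in_entries N (\<lambda>_. c)"
| entry: "i < N \<Longrightarrow> j < N \<Longrightarrow> polynomial_in_entries N (\<lambda>A. A $$ (i, j))"
| add: "polynomial_in_entries N p \<Longrightarrow> polynomial_in_entries N q \<Longrightarrow>
          polynomial_in_entries N (\<lambda>A. p A + q A)"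
| mult: "polynomial_in_entries N p \<Longrightarrow> polynomial_in_entries N q \<Longrightarrow>
          polynomial_in_entries N (\<lambda>A. p A * q A)"

text \<open>
  Regular functions on the general linear group also involve the inverse of the determinant,
  but a regular function vanishes where its numerator does, so polynomials suffice.
\<close>

definition zariski_topology :: "nat \<Rightarrow> real mat topology" where
  "zariski_topology N =
     topology_generated_by
       {{A \<in> carrier (general_linear_group N). p A \<noteq> 0} | p. polynomial_in_entries N p}"

text \<open>The entries are restricted because \<^const>\<open>index_mat\<close> is unspecified outside the matrix.\<close>

definition euclidean_mat_topology :: "nat \<Rightarrow> real mat topology" where
  "euclidean_mat_topology N =
     pullback_topology (carrier_mat N N)
       (\<lambda>A. \<lambda>ij \<in> {..<N} \<times> {..<N}. A $$ ij)
       (product_topology (\<lambda>_. euclideanreal) ({..<N} \<times> {..<N}))"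

definition real_algebraic_group :: "nat \<Rightarrow> real mat set \<Rightarrow> bool" where
  "real_algebraic_group N G \<longleftrightarrow>
     subgroup G (general_linear_group N) \<and> closedin (zariski_topology N) G"

text \<open>
  Semisimple: Zariski connected with trivial radical. A real algebraic group is identified with
  its group of real points; since the radical is defined over the reals and the real points of a
  connected group are Zariski dense, the radical is trivial iff its real points are.
\<close>

definition semisimple_real_algebraic_group :: "nat \<Rightarrow> real mat set \<Rightarrow> bool" where
  "semisimple_real_algebraic_group N G \<longleftrightarrow>
     real_algebraic_group N G \<and>
     connectedin (zariski_topology N) G \<and>
     (\<forall>R. R \<lhd> (general_linear_group N\<lparr>carrier := G\<rparr>) \<and>
          closedin (zariski_topology N) R \<and>
          connectedin (zariski_topology N) R \<and>
          solvable (general_linear_group N\<lparr>carrier := R\<rparr>)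
          \<longrightarrow> R = {\<one>\<^bsub>general_linear_group N\<^esub>})"

definition large_group :: "('a, 'b) monoid_scheme \<Rightarrow> bool" where
  "large_group \<Gamma> \<longleftrightarrow>
     (\<exists>N G \<rho>.
        semisimple_real_algebraic_group N G \<and>
        \<not> compactin (euclidean_mat_topology N) G \<and>
        \<rho> \<in> hom \<Gamma> (general_linear_group N\<lparr>carrier := G\<rparr>) \<and>
        zariski_topology N closure_of (\<rho> ` carrier \<Gamma>) = G)"

end

theory Submission
  imports Defs
begin

text \<open>
  Among the \<open>m\<close> hyperplanes, \<open>n + 3\<close> have a cross ratio. Let \<open>N = n + 1\<close>. The hyperplanes number
  \<open>2, \<dots>, N - 1\<close> meet in a line, which the four hyperplanes \<open>0\<close>, \<open>1\<close>, \<open>N\<close>, \<open>N + 1\<close> cut in four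
  points, and general position makes these points distinct. So the cross ratio is a continuous map
  from the moduli space to the plane punctured at \<open>0\<close> and \<open>1\<close>. The fundamental group of the
  punctured plane is free on two generators, and sending them to the unipotent matrices
  \<open>upper 1\<close> and \<open>lower 1\<close> gives a representation of the fundamental group of the moduli space in
  the real special linear group of degree two.

  The image of this representation is still Zariski dense at every base point, because the cross
  ratio has a section through any given configuration, defined off a finite set: hyperplane \<open>0\<close>
  is moved in the pencil that it spans with hyperplane \<open>1\<close>, the others staying fixed, and general
  position fails for finitely many members of the pencil only (\<open>cross_ratio_section\<close>). A loop in
  the plane can be chosen to avoid a finite set, so up to a common conjugation both unipotent
  generators are in the image (\<open>large_fundamental_group_over_punctured_plane\<close>). They generate a
  Zariski dense subgroup, since a polynomial that vanishes at all integral powers of a unipotent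
  matrix vanishes on its one-parameter group (\<open>zariski_dense_SL2\<close>).

  The representation is constructed as the holonomy of a flat bundle and not through a
  presentation of a fundamental group. The punctured plane is covered by three slit planes: each
  is the union of the open upper half plane, the open lower half plane and one of the intervals
  into which \<open>0\<close> and \<open>1\<close> cut the real line. Crossing the \<open>k\<close>-th interval downwards multiplies by
  a prescribed group element. That the holonomy of a locally constant cocycle is a homomorphism
  from the fundamental group (\<open>holonomy_hom\<close>) is proved for arbitrary spaces.
\<close>

section \<open>Holonomy of a flat cocycle\<close>

context group
begin

lemma inv_cancel_left:
  assumes "x \<in> carrier G" "y \<in> carrier G"
  shows "inv\<^bsub>G\<^esub> x \<otimes> (x \<otimes> y) = y" and "x \<otimes> (inv\<^bsub>G\<^esub> x \<otimes> y) = y"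
  using assms by (simp_all flip: m_assoc)

text \<open>
  Transport around a rectangle will be written as a commuting square, so that subdividing the
  rectangle in either direction is an instance of pasting.
\<close>

lemma commuting_squares_paste:
  assumes "a \<otimes> m = l \<otimes> a'" "b \<otimes> r = m \<otimes> b'"
    and "a \<in> carrier G" "a' \<in> carrier G" "b \<in> carrier G" "b' \<in> carrier G"
      "l \<in> carrier G" "m \<in> carrier G" "r \<in> carrier G"
  shows "(a \<otimes> b) \<otimes> r = l \<otimes> (a' \<otimes> b')"
proof -
  have "(a \<otimes> b) \<otimes> r = a \<otimes> (m \<otimes> b')"
    using assms by (simp add: m_assoc)
  also have "\<dots> = l \<otimes> a' \<otimes> b'"
    using assms by (simp flip: m_assoc assms(1))
  finally show ?thesis
    using assms by (simp add: m_assoc)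
qed

end

text \<open>
  A flat principal bundle, presented on the trivial bundle with fibre \<open>G\<close>: over \<open>U k\<close> a
  \<open>G\<close>-valued function \<open>\<Phi>\<close> counts as horizontal if \<open>\<Phi> \<otimes> \<tau> k\<close> is locally constant, and the last
  assumption makes these local notions agree on overlaps. Local constancy is expressed as
  continuity into a discrete space.
\<close>

locale flat_cocycle = group G for G (structure) +
  fixes X :: "'a topology" and K :: "'k set" and U :: "'k \<Rightarrow> 'a set" and \<tau> :: "'k \<Rightarrow> 'a \<Rightarrow> 'b"
  assumes open_chart: "k \<in> K \<Longrightarrow> openin X (U k)"
    and charts_cover: "x \<in> topspace X \<Longrightarrow> \<exists>k\<in>K. x \<in> U k"
    and frame_closed: "k \<in> K \<Longrightarrow> x \<in> U k \<Longrightarrow> \<tau> k x \<in> carrier G"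
    and flat: "j \<in> K \<Longrightarrow> k \<in> K \<Longrightarrow>
      continuous_map (subtopology X (U j \<inter> U k)) (discrete_topology (carrier G))
        (\<lambda>x. inv\<^bsub>G\<^esub> (\<tau> j x) \<otimes> \<tau> k x)"
begin

abbreviation path_on :: "(real \<Rightarrow> 'a) \<Rightarrow> real \<Rightarrow> real \<Rightarrow> bool" where
  "path_on g a b \<equiv> continuous_map (top_of_set {a..b}) X g"

lemma path_on_subinterval: "path_on g a b \<Longrightarrow> a \<le> c \<Longrightarrow> d \<le> b \<Longrightarrow> path_on g c d"
  by (rule continuous_map_from_subtopology_mono[where T = "{a..b}"]) auto

lemma path_on_in_topspace: "path_on g a b \<Longrightarrow> t \<in> {a..b} \<Longrightarrow> g t \<in> topspace X"
  by (auto simp: continuous_map_def Pi_def)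

lemma path_stays_in_chart:
  assumes "path_on g a b" "x \<in> {a..b}"
  obtains k d where "k \<in> K" "d > 0" "\<And>y. y \<in> {a..b} \<Longrightarrow> \<bar>y - x\<bar> < d \<Longrightarrow> g y \<in> U k"
proof -
  obtain k where k: "k \<in> K" "g x \<in> U k"
    using charts_cover[OF path_on_in_topspace[OF assms]] by blast
  have "openin (top_of_set {a..b}) {y \<in> {a..b}. g y \<in> U k}"
    using openin_continuous_map_preimage[OF assms(1) open_chart[OF k(1)]] by simp
  then obtain d where "d > 0" "\<And>y. y \<in> {a..b} \<Longrightarrow> dist y x < d \<Longrightarrow> y \<in> {y \<in> {a..b}. g y \<in> U k}"
    using k assms(2) unfolding openin_euclidean_subtopology_iff by blast
  then show ?thesis
    using that[of k d] k(1) by (auto simp: dist_real_def)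
qed

lemma frame_change_constant:
  assumes "path_on g a b" "g ` {a..b} \<subseteq> U j \<inter> U k" "j \<in> K" "k \<in> K" "x \<in> {a..b}" "y \<in> {a..b}"
  shows "inv\<^bsub>G\<^esub> (\<tau> j (g x)) \<otimes> \<tau> k (g x) = inv\<^bsub>G\<^esub> (\<tau> j (g y)) \<otimes> \<tau> k (g y)"
proof -
  have "continuous_map (top_of_set {a..b}) (subtopology X (U j \<inter> U k)) g"
    using assms by (auto simp: continuous_map_in_subtopology)
  then have "continuous_map (top_of_set {a..b}) (discrete_topology (carrier G))
      ((\<lambda>x. inv\<^bsub>G\<^esub> (\<tau> j x) \<otimes> \<tau> k x) \<circ> g)"
    using flat[OF assms(3,4)] continuous_map_compose by blast
  then have "connectedin (discrete_topology (carrier G))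
      (((\<lambda>x. inv\<^bsub>G\<^esub> (\<tau> j x) \<otimes> \<tau> k x) \<circ> g) ` {a..b})"
    by (rule connectedin_continuous_map_image) (simp add: connectedin_subtopology)
  then obtain c where "((\<lambda>x. inv\<^bsub>G\<^esub> (\<tau> j x) \<otimes> \<tau> k x) \<circ> g) ` {a..b} \<subseteq> {c}"
    by (auto simp: connectedin_discrete_topology)
  then show ?thesis
    using assms(5,6) by (auto simp: image_subset_iff)
qed

text \<open>
  Transport is characterized on all subintervals at once, by additivity and by its value inside a
  chart. This makes it unique, and every later property of transport is proved by checking the
  characterization for a suitable \<open>T\<close>.
\<close>

definition parallel_transport_on :: "(real \<Rightarrow> 'a) \<Rightarrow> real \<Rightarrow> real \<Rightarrow> (real \<Rightarrow> real \<Rightarrow> 'b) \<Rightarrow> bool" where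
  "parallel_transport_on g a b T \<longleftrightarrow>
     (\<forall>c d. a \<le> c \<longrightarrow> c \<le> d \<longrightarrow> d \<le> b \<longrightarrow> T c d \<in> carrier G) \<and>
     (\<forall>c d e. a \<le> c \<longrightarrow> c \<le> d \<longrightarrow> d \<le> e \<longrightarrow> e \<le> b \<longrightarrow> T c e = T c d \<otimes> T d e) \<and>
     (\<forall>c d k. a \<le> c \<longrightarrow> c \<le> d \<longrightarrow> d \<le> b \<longrightarrow> k \<in> K \<longrightarrow> g ` {c..d} \<subseteq> U k \<longrightarrow>
        T c d = \<tau> k (g c) \<otimes> inv\<^bsub>G\<^esub> (\<tau> k (g d)))"

lemma parallel_transport_onD:
  assumes "parallel_transport_on g a b T"
  shows "a \<le> c \<Longrightarrow> c \<le> d \<Longrightarrow> d \<le> b \<Longrightarrow> T c d \<in> carrier G"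
    and "a \<le> c \<Longrightarrow> c \<le> d \<Longrightarrow> d \<le> e \<Longrightarrow> e \<le> b \<Longrightarrow> T c e = T c d \<otimes> T d e"
    and "a \<le> c \<Longrightarrow> c \<le> d \<Longrightarrow> d \<le> b \<Longrightarrow> k \<in> K \<Longrightarrow> (\<And>t. c \<le> t \<Longrightarrow> t \<le> d \<Longrightarrow> g t \<in> U k) \<Longrightarrow>
        T c d = \<tau> k (g c) \<otimes> inv\<^bsub>G\<^esub> (\<tau> k (g d))"
proof -
  note D = assms[unfolded parallel_transport_on_def]
  show "a \<le> c \<Longrightarrow> c \<le> d \<Longrightarrow> d \<le> b \<Longrightarrow> T c d \<in> carrier G"
    by (rule D[THEN conjunct1, rule_format])
  show "a \<le> c \<Longrightarrow> c \<le> d \<Longrightarrow> d \<le> e \<Longrightarrow> e \<le> b \<Longrightarrow> T c e = T c d \<otimes> T d e"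
    by (rule D[THEN conjunct2, THEN conjunct1, rule_format])
  show "T c d = \<tau> k (g c) \<otimes> inv\<^bsub>G\<^esub> (\<tau> k (g d))"
    if "a \<le> c" "c \<le> d" "d \<le> b" "k \<in> K" "\<And>t. c \<le> t \<Longrightarrow> t \<le> d \<Longrightarrow> g t \<in> U k"
    using that by (intro D[THEN conjunct2, THEN conjunct2, rule_format]) auto
qed

lemma parallel_transport_onI:
  assumes "\<And>c d. a \<le> c \<Longrightarrow> c \<le> d \<Longrightarrow> d \<le> b \<Longrightarrow> T c d \<in> carrier G"
    and "\<And>c d e. a \<le> c \<Longrightarrow> c \<le> d \<Longrightarrow> d \<le> e \<Longrightarrow> e \<le> b \<Longrightarrow> T c e = T c d \<otimes> T d e"
    and "\<And>c d k. a \<le> c \<Longrightarrow> c \<le> d \<Longrightarrow> d \<le> b \<Longrightarrow> k \<in> K \<Longrightarrow> (\<And>t. c \<le> t \<Longrightarrow> t \<le> d \<Longrightarrow> g t \<in> U k) \<Longrightarrow>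
        T c d = \<tau> k (g c) \<otimes> inv\<^bsub>G\<^esub> (\<tau> k (g d))"
  shows "parallel_transport_on g a b T"
  unfolding parallel_transport_on_def image_subset_iff
proof (intro conjI allI impI)
  show "T c d \<in> carrier G" if "a \<le> c" "c \<le> d" "d \<le> b" for c d
    using that by (rule assms(1))
  show "T c e = T c d \<otimes> T d e" if "a \<le> c" "c \<le> d" "d \<le> e" "e \<le> b" for c d e
    using that by (rule assms(2))
  show "T c d = \<tau> k (g c) \<otimes> inv\<^bsub>G\<^esub> (\<tau> k (g d))"
    if "a \<le> c" "c \<le> d" "d \<le> b" "k \<in> K" "\<forall>x\<in>{c..d}. g x \<in> U k" for c d k
    using that(1-4) by (rule assms(3)) (use that(5) in auto)
qed

text \<open>
  Two candidates agree on intervals so short that the path stays in one chart, and agreement is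
  additive; bisection does the rest.
\<close>

lemma parallel_transport_unique:
  assumes "path_on g a b" "a \<le> b" "parallel_transport_on g a b T" "parallel_transport_on g a b T'"
  shows "T a b = T' a b"
proof -
  have "a \<le> a \<longrightarrow> b \<le> b \<longrightarrow> T a b = T' a b"
    using \<open>a \<le> b\<close>
  proof (induction rule: Bolzano[where P = "\<lambda>c d. a \<le> c \<longrightarrow> d \<le> b \<longrightarrow> T c d = T' c d"])
    case (trans c d e)
    show ?case
    proof (intro impI)
      assume ce: "a \<le> c" "e \<le> b"
      have "T c e = T c d \<otimes> T d e" "T' c e = T' c d \<otimes> T' d e"
        using ce trans(3,4) parallel_transport_onD(2)[OF assms(3)] parallel_transport_onD(2)[OF assms(4)] by blast+
      moreover have "T c d = T' c d" "T d e = T' d e"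
        using trans ce by auto
      ultimately show "T c e = T' c e" by simp
    qed
  next
    case (local x)
    obtain k \<delta> where k: "k \<in> K" "\<delta> > 0" "\<And>y. y \<in> {a..b} \<Longrightarrow> \<bar>y - x\<bar> < \<delta> \<Longrightarrow> g y \<in> U k"
      using path_stays_in_chart[OF assms(1)] local by (metis atLeastAtMost_iff)
    show ?case
    proof (intro exI[of _ \<delta>] conjI allI impI)
      fix c d assume *: "c \<le> x \<and> x \<le> d \<and> d - c < \<delta>" "a \<le> c" "d \<le> b"
      have inU: "g t \<in> U k" if "c \<le> t" "t \<le> d" for t
        using that * by (intro k(3)) auto
      have "T c d = \<tau> k (g c) \<otimes> inv\<^bsub>G\<^esub> (\<tau> k (g d))"
        using * k(1) inU by (intro parallel_transport_onD(3)[OF assms(3)]) auto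
      moreover have "T' c d = \<tau> k (g c) \<otimes> inv\<^bsub>G\<^esub> (\<tau> k (g d))"
        using * k(1) inU by (intro parallel_transport_onD(3)[OF assms(4)]) auto
      ultimately show "T c d = T' c d" by simp
    qed fact
  qed
  then show ?thesis by simp
qed

text \<open>
  Horizontal lifts serve only to prove that transport exists: unlike transports, which are indexed
  by two end points, they can be glued.
\<close>

definition horizontal_on :: "(real \<Rightarrow> 'a) \<Rightarrow> real \<Rightarrow> real \<Rightarrow> (real \<Rightarrow> 'b) \<Rightarrow> bool" where
  "horizontal_on g a b \<Phi> \<longleftrightarrow>
     (\<forall>t. a \<le> t \<longrightarrow> t \<le> b \<longrightarrow> \<Phi> t \<in> carrier G) \<and>
     (\<forall>c d k. a \<le> c \<longrightarrow> c \<le> d \<longrightarrow> d \<le> b \<longrightarrow> k \<in> K \<longrightarrow> (\<forall>t. c \<le> t \<longrightarrow> t \<le> d \<longrightarrow> g t \<in> U k) \<longrightarrow>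
        \<Phi> d = \<Phi> c \<otimes> (\<tau> k (g c) \<otimes> inv\<^bsub>G\<^esub> (\<tau> k (g d))))"

lemma horizontal_onD:
  assumes "horizontal_on g a b \<Phi>"
  shows "a \<le> t \<Longrightarrow> t \<le> b \<Longrightarrow> \<Phi> t \<in> carrier G"
    and "a \<le> c \<Longrightarrow> c \<le> d \<Longrightarrow> d \<le> b \<Longrightarrow> k \<in> K \<Longrightarrow> (\<And>t. c \<le> t \<Longrightarrow> t \<le> d \<Longrightarrow> g t \<in> U k) \<Longrightarrow>
        \<Phi> d = \<Phi> c \<otimes> (\<tau> k (g c) \<otimes> inv\<^bsub>G\<^esub> (\<tau> k (g d)))"
proof -
  note D = assms[unfolded horizontal_on_def]
  show "a \<le> t \<Longrightarrow> t \<le> b \<Longrightarrow> \<Phi> t \<in> carrier G"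
    by (rule D[THEN conjunct1, rule_format])
  show "\<Phi> d = \<Phi> c \<otimes> (\<tau> k (g c) \<otimes> inv\<^bsub>G\<^esub> (\<tau> k (g d)))"
    if "a \<le> c" "c \<le> d" "d \<le> b" "k \<in> K" "\<And>t. c \<le> t \<Longrightarrow> t \<le> d \<Longrightarrow> g t \<in> U k"
    using that by (intro D[THEN conjunct2, rule_format]) auto
qed

lemma horizontal_on_chart:
  assumes g: "path_on g a b" and k: "k \<in> K" "\<And>t. a \<le> t \<Longrightarrow> t \<le> b \<Longrightarrow> g t \<in> U k"
  shows "horizontal_on g a b (\<lambda>t. inv\<^bsub>G\<^esub> (\<tau> k (g t)))"
  unfolding horizontal_on_def
proof (intro conjI allI impI)
  show "inv\<^bsub>G\<^esub> (\<tau> k (g t)) \<in> carrier G" if "a \<le> t" "t \<le> b" for t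
    using frame_closed k that by simp
  fix c d j assume cd: "a \<le> c" "c \<le> d" "d \<le> b" "j \<in> K" "\<forall>t. c \<le> t \<longrightarrow> t \<le> d \<longrightarrow> g t \<in> U j"
  have cl: "\<tau> j (g c) \<in> carrier G" "\<tau> j (g d) \<in> carrier G" "\<tau> k (g c) \<in> carrier G" "\<tau> k (g d) \<in> carrier G"
    using cd k by (auto intro!: frame_closed)
  have "inv\<^bsub>G\<^esub> (\<tau> k (g c)) \<otimes> \<tau> j (g c) = inv\<^bsub>G\<^esub> (\<tau> k (g d)) \<otimes> \<tau> j (g d)"
    using cd k by (intro frame_change_constant[OF path_on_subinterval[OF g cd(1,3)]]) auto
  then show "inv\<^bsub>G\<^esub> (\<tau> k (g d)) = inv\<^bsub>G\<^esub> (\<tau> k (g c)) \<otimes> (\<tau> j (g c) \<otimes> inv\<^bsub>G\<^esub> (\<tau> j (g d)))"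
    using cl by (simp add: m_assoc flip: m_assoc[of "inv\<^bsub>G\<^esub> (\<tau> k (g c))"])
qed

text \<open>
  The lift over the second interval is translated on the left so as to start where the first one
  ends; left translation commutes with the right multiplication in the definition.
\<close>

lemma horizontal_on_glue:
  assumes 1: "horizontal_on g a b \<Phi>" and 2: "horizontal_on g b c \<Psi>" and abc: "a \<le> b" "b \<le> c"
  shows "horizontal_on g a c (\<lambda>t. if t \<le> b then \<Phi> t else \<Phi> b \<otimes> inv\<^bsub>G\<^esub> (\<Psi> b) \<otimes> \<Psi> t)"
  unfolding horizontal_on_def
proof (intro conjI allI impI)
  have cl: "\<Phi> b \<in> carrier G" "\<Psi> b \<in> carrier G"
    using horizontal_onD(1)[OF 1] horizontal_onD(1)[OF 2] abc by auto
  show "(if t \<le> b then \<Phi> t else \<Phi> b \<otimes> inv\<^bsub>G\<^esub> (\<Psi> b) \<otimes> \<Psi> t) \<in> carrier G" if "a \<le> t" "t \<le> c" for t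
    using that horizontal_onD(1)[OF 1, of t] horizontal_onD(1)[OF 2, of t] cl by auto
  fix d e k assume de: "a \<le> d" "d \<le> e" "e \<le> c" "k \<in> K" "\<forall>t. d \<le> t \<longrightarrow> t \<le> e \<longrightarrow> g t \<in> U k"
  have fr: "\<tau> k (g d) \<in> carrier G" "\<tau> k (g e) \<in> carrier G"
    using de by (auto intro!: frame_closed)
  consider "e \<le> b" | "b < d" | "d \<le> b" "b < e" by linarith
  then show "(if e \<le> b then \<Phi> e else \<Phi> b \<otimes> inv\<^bsub>G\<^esub> (\<Psi> b) \<otimes> \<Psi> e) =
      (if d \<le> b then \<Phi> d else \<Phi> b \<otimes> inv\<^bsub>G\<^esub> (\<Psi> b) \<otimes> \<Psi> d) \<otimes> (\<tau> k (g d) \<otimes> inv\<^bsub>G\<^esub> (\<tau> k (g e)))"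
  proof cases
    case 1
    then show ?thesis
      using horizontal_onD(2)[OF assms(1) de(1,2) _ de(4)] de(2,5) by simp
  next
    case 2
    have "\<Psi> e = \<Psi> d \<otimes> (\<tau> k (g d) \<otimes> inv\<^bsub>G\<^esub> (\<tau> k (g e)))"
      using 2 de by (intro horizontal_onD(2)[OF assms(2)]) auto
    moreover have "\<Psi> d \<in> carrier G"
      using 2 de horizontal_onD(1)[OF assms(2)] by auto
    ultimately show ?thesis
      using 2 de fr cl by (simp add: m_assoc)
  next
    case 3
    have fb: "\<tau> k (g b) \<in> carrier G"
      using 3 de by (auto intro!: frame_closed)
    have "\<Psi> e = \<Psi> b \<otimes> (\<tau> k (g b) \<otimes> inv\<^bsub>G\<^esub> (\<tau> k (g e)))"
      using 3 de by (intro horizontal_onD(2)[OF assms(2)]) auto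
    moreover have "\<Phi> b = \<Phi> d \<otimes> (\<tau> k (g d) \<otimes> inv\<^bsub>G\<^esub> (\<tau> k (g b)))"
      using 3 de by (intro horizontal_onD(2)[OF assms(1)]) auto
    moreover have "\<Phi> d \<in> carrier G" "\<Psi> b \<in> carrier G"
      using 3 de cl horizontal_onD(1)[OF assms(1)] by auto
    ultimately show ?thesis
      using 3 fr fb by (simp add: m_assoc inv_cancel_left)
  qed
qed

lemma horizontal_on_exists:
  assumes "path_on g a b" "a \<le> b"
  shows "\<exists>\<Phi>. horizontal_on g a b \<Phi>"
proof -
  have "a \<le> a \<longrightarrow> b \<le> b \<longrightarrow> (\<exists>\<Phi>. horizontal_on g a b \<Phi>)"
    using \<open>a \<le> b\<close>
  proof (induction rule: Bolzano[where P = "\<lambda>c d. a \<le> c \<longrightarrow> d \<le> b \<longrightarrow> (\<exists>\<Phi>. horizontal_on g c d \<Phi>)"])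
    case (trans c d e)
    then show ?case using horizontal_on_glue by (meson order_trans)
  next
    case (local x)
    obtain k \<delta> where k: "k \<in> K" "\<delta> > 0" "\<And>y. y \<in> {a..b} \<Longrightarrow> \<bar>y - x\<bar> < \<delta> \<Longrightarrow> g y \<in> U k"
      using path_stays_in_chart[OF assms(1)] local by (metis atLeastAtMost_iff)
    show ?case
    proof (intro exI[of _ \<delta>] conjI allI impI)
      fix c d assume *: "c \<le> x \<and> x \<le> d \<and> d - c < \<delta>" "a \<le> c" "d \<le> b"
      have "horizontal_on g c d (\<lambda>t. inv\<^bsub>G\<^esub> (\<tau> k (g t)))"
        using * k(1) by (intro horizontal_on_chart path_on_subinterval[OF assms(1)] k) auto
      then show "\<exists>\<Phi>. horizontal_on g c d \<Phi>" by blast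
    qed fact
  qed
  then show ?thesis by simp
qed

lemma parallel_transport_exists:
  assumes "path_on g a b" "a \<le> b"
  shows "\<exists>T. parallel_transport_on g a b T"
proof -
  obtain \<Phi> where \<Phi>: "horizontal_on g a b \<Phi>"
    using horizontal_on_exists[OF assms] by blast
  note cl = horizontal_onD(1)[OF \<Phi>]
  have "parallel_transport_on g a b (\<lambda>c d. inv\<^bsub>G\<^esub> (\<Phi> c) \<otimes> \<Phi> d)"
  proof (rule parallel_transport_onI)
    fix c d assume cd: "a \<le> c" "c \<le> d" "d \<le> b"
    then show "inv\<^bsub>G\<^esub> (\<Phi> c) \<otimes> \<Phi> d \<in> carrier G" using cl by simp
  next
    fix c d e assume "a \<le> c" "c \<le> d" "d \<le> e" "e \<le> b"
    then have "\<Phi> c \<in> carrier G" "\<Phi> d \<in> carrier G" "\<Phi> e \<in> carrier G"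
      using cl by auto
    then show "inv\<^bsub>G\<^esub> (\<Phi> c) \<otimes> \<Phi> e = inv\<^bsub>G\<^esub> (\<Phi> c) \<otimes> \<Phi> d \<otimes> (inv\<^bsub>G\<^esub> (\<Phi> d) \<otimes> \<Phi> e)"
      by (simp add: m_assoc inv_cancel_left)
  next
    fix c d k assume cd: "a \<le> c" "c \<le> d" "d \<le> b" "k \<in> K" "\<And>t. c \<le> t \<Longrightarrow> t \<le> d \<Longrightarrow> g t \<in> U k"
    then have "\<Phi> d = \<Phi> c \<otimes> (\<tau> k (g c) \<otimes> inv\<^bsub>G\<^esub> (\<tau> k (g d)))"
      by (intro horizontal_onD(2)[OF \<Phi>]) auto
    moreover have "\<Phi> c \<in> carrier G" "\<Phi> d \<in> carrier G" "\<tau> k (g c) \<otimes> inv\<^bsub>G\<^esub> (\<tau> k (g d)) \<in> carrier G"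
      using cd cl by (auto intro!: frame_closed)
    ultimately show "inv\<^bsub>G\<^esub> (\<Phi> c) \<otimes> \<Phi> d = \<tau> k (g c) \<otimes> inv\<^bsub>G\<^esub> (\<tau> k (g d))"
      by (simp add: inv_cancel_left)
  qed
  then show ?thesis by blast
qed

definition transport :: "(real \<Rightarrow> 'a) \<Rightarrow> real \<Rightarrow> real \<Rightarrow> 'b" where
  "transport g a b = (SOME T. parallel_transport_on g a b T) a b"

lemma transport_eqI:
  assumes "path_on g a b" "a \<le> b" "parallel_transport_on g a b T"
  shows "transport g a b = T a b"
proof -
  have "parallel_transport_on g a b (SOME T. parallel_transport_on g a b T)"
    by (rule someI[of "parallel_transport_on g a b", OF assms(3)])
  then show ?thesis
    unfolding transport_def using parallel_transport_unique[OF assms(1,2) _ assms(3)] by blast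
qed

lemma transport_closed:
  assumes "path_on g a b" "a \<le> b"
  shows "transport g a b \<in> carrier G"
  using parallel_transport_exists[OF assms] transport_eqI[OF assms] parallel_transport_onD(1) assms(2)
  by (metis order_refl)

lemma parallel_transport_on_subinterval:
  assumes "parallel_transport_on g a b T" "a \<le> c" "d \<le> b"
  shows "parallel_transport_on g c d T"
  by (rule parallel_transport_onI; rule parallel_transport_onD[OF assms(1)])
    (use assms(2,3) in linarith)+

lemma transport_is_parallel:
  assumes "path_on g a b"
  shows "parallel_transport_on g a b (transport g)"
proof (cases "a \<le> b")
  case True
  obtain T where T: "parallel_transport_on g a b T"
    using parallel_transport_exists[OF assms True] by blast
  have eq: "transport g c d = T c d" if "a \<le> c" "c \<le> d" "d \<le> b" for c d
    using that by (intro transport_eqI path_on_subinterval[OF assms] parallel_transport_on_subinterval[OF T]) auto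
  show ?thesis
  proof (rule parallel_transport_onI)
    fix c d assume cd: "a \<le> c" "c \<le> d" "d \<le> b"
    show "transport g c d \<in> carrier G"
      using parallel_transport_onD(1)[OF T cd] eq[OF cd] by simp
    show "transport g c d = \<tau> k (g c) \<otimes> inv\<^bsub>G\<^esub> (\<tau> k (g d))"
      if "k \<in> K" "\<And>t. c \<le> t \<Longrightarrow> t \<le> d \<Longrightarrow> g t \<in> U k" for k
      using parallel_transport_onD(3)[OF T cd that] eq[OF cd] by simp
  next
    show "transport g c e = transport g c d \<otimes> transport g d e"
      if "a \<le> c" "c \<le> d" "d \<le> e" "e \<le> b" for c d e
      using parallel_transport_onD(2)[OF T that] eq[of c d] eq[of c e] eq[of d e] that by simp
  qed
next
  case False
  then show ?thesis by (auto simp: parallel_transport_on_def)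
qed

lemma transport_trans:
  assumes "path_on g a c" "a \<le> b" "b \<le> c"
  shows "transport g a c = transport g a b \<otimes> transport g b c"
  using parallel_transport_onD(2)[OF transport_is_parallel[OF assms(1)]] assms(2,3) by blast

lemma transport_in_chart:
  assumes "path_on g a b" "a \<le> b" "k \<in> K" "\<And>t. a \<le> t \<Longrightarrow> t \<le> b \<Longrightarrow> g t \<in> U k"
  shows "transport g a b = \<tau> k (g a) \<otimes> inv\<^bsub>G\<^esub> (\<tau> k (g b))"
  using parallel_transport_onD(3)[OF transport_is_parallel[OF assms(1)]] assms(2-) by blast

lemma transport_constant:
  assumes "x \<in> topspace X" "a \<le> b"
  shows "transport (\<lambda>_. x) a b = \<one>"
proof -
  obtain k where k: "k \<in> K" "x \<in> U k" using charts_cover assms(1) by blast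
  have "transport (\<lambda>_. x) a b = \<tau> k x \<otimes> inv\<^bsub>G\<^esub> (\<tau> k x)"
    using assms k by (intro transport_in_chart) auto
  then show ?thesis using frame_closed[OF k] by simp
qed

lemma transport_reparametrize:
  assumes g: "path_on g (\<alpha> * a + \<beta>) (\<alpha> * b + \<beta>)" and ab: "a \<le> b" and \<alpha>: "\<alpha> > 0"
    and h: "path_on h a b" "\<And>t. a \<le> t \<Longrightarrow> t \<le> b \<Longrightarrow> h t = g (\<alpha> * t + \<beta>)"
  shows "transport h a b = transport g (\<alpha> * a + \<beta>) (\<alpha> * b + \<beta>)"
proof (rule transport_eqI[OF h(1) ab])
  note D = parallel_transport_onD[OF transport_is_parallel[OF g]]
  show "parallel_transport_on h a b (\<lambda>c d. transport g (\<alpha> * c + \<beta>) (\<alpha> * d + \<beta>))"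
  proof (rule parallel_transport_onI)
    show "transport g (\<alpha> * c + \<beta>) (\<alpha> * d + \<beta>) \<in> carrier G" if "a \<le> c" "c \<le> d" "d \<le> b" for c d
      using that \<alpha> by (intro D(1)) auto
    show "transport g (\<alpha> * c + \<beta>) (\<alpha> * e + \<beta>) =
        transport g (\<alpha> * c + \<beta>) (\<alpha> * d + \<beta>) \<otimes> transport g (\<alpha> * d + \<beta>) (\<alpha> * e + \<beta>)"
      if "a \<le> c" "c \<le> d" "d \<le> e" "e \<le> b" for c d e
      using that \<alpha> by (intro D(2)) auto
  next
    fix c d k assume cd: "a \<le> c" "c \<le> d" "d \<le> b" "k \<in> K" "\<And>t. c \<le> t \<Longrightarrow> t \<le> d \<Longrightarrow> h t \<in> U k"
    have "g t \<in> U k" if "\<alpha> * c + \<beta> \<le> t" "t \<le> \<alpha> * d + \<beta>" for t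
    proof -
      define u where "u = (t - \<beta>) / \<alpha>"
      have t: "t = \<alpha> * u + \<beta>" using \<alpha> by (simp add: u_def)
      then have "c \<le> u" "u \<le> d" using that \<alpha> by auto
      then show ?thesis using cd(1,3) cd(5)[of u] h(2)[of u] t by simp
    qed
    then show "transport g (\<alpha> * c + \<beta>) (\<alpha> * d + \<beta>) = \<tau> k (h c) \<otimes> inv\<^bsub>G\<^esub> (\<tau> k (h d))"
      using D(3)[of "\<alpha> * c + \<beta>" "\<alpha> * d + \<beta>" k] cd(1-4) \<alpha> h(2)[of c] h(2)[of d] by simp
  qed
qed

lemma pathin_concat:
  assumes "pathin X g" "pathin X h" "g 1 = h 0"
  shows "pathin X (concat_loops g h)"
proof -
  have "continuous_map (top_of_set {0..1}) X (\<lambda>t. if t \<le> 1/2 then g (2 * t) else h (2 * t - 1))"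
  proof (rule continuous_map_cases_le)
    show "continuous_map (subtopology (top_of_set {0..1}) {x \<in> topspace (top_of_set {0..1}). x \<le> 1 / 2}) X (\<lambda>t. g (2 * t))"
      using assms(1) unfolding pathin_def
      by (intro continuous_map_compose[of _ "top_of_set {0..1}" "\<lambda>t. 2 * t" X g, unfolded o_def])
        (auto simp: subtopology_subtopology intro!: continuous_intros)
    show "continuous_map (subtopology (top_of_set {0..1}) {x \<in> topspace (top_of_set {0..1}). 1 / 2 \<le> x}) X (\<lambda>t. h (2 * t - 1))"
      using assms(2) unfolding pathin_def
      by (intro continuous_map_compose[of _ "top_of_set {0..1}" "\<lambda>t. 2 * t - 1" X h, unfolded o_def])
        (auto simp: subtopology_subtopology intro!: continuous_intros)
    show "g (2 * x) = h (2 * x - 1)" if "x = 1/2" for x :: real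
      unfolding that using assms(3) by simp
  qed auto
  then show ?thesis by (simp add: pathin_def concat_loops_def)
qed

lemma transport_concat:
  assumes "pathin X g" "pathin X h" "g 1 = h 0"
  shows "transport (concat_loops g h) 0 1 = transport g 0 1 \<otimes> transport h 0 1"
proof -
  have p: "path_on (concat_loops g h) 0 1" "path_on g 0 1" "path_on h 0 1"
    using pathin_concat[OF assms] assms by (auto simp: pathin_def)
  have "transport (concat_loops g h) 0 (1/2) = transport g (2 * 0 + 0) (2 * (1/2) + 0)"
    using p by (intro transport_reparametrize path_on_subinterval[OF p(1)]) (auto simp: concat_loops_def)
  moreover have "transport (concat_loops g h) (1/2) 1 = transport h (2 * (1/2) + (-1)) (2 * 1 + (-1))"
  proof (intro transport_reparametrize path_on_subinterval[OF p(1)])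
    show "concat_loops g h t = h (2 * t + - 1)" if "1/2 \<le> t" "t \<le> 1" for t
    proof (cases "t = 1/2")
      case True
      show ?thesis unfolding True using assms(3) by (simp add: concat_loops_def)
    next
      case False
      then show ?thesis using that by (simp add: concat_loops_def)
    qed
  qed (use p in auto)
  ultimately show ?thesis
    using transport_trans[OF p(1), of "1/2"] by simp
qed

text \<open>
  Transport around a rectangle inside one chart is trivial, and this property is preserved when
  rectangles are pasted along a vertical or a horizontal edge. Compactness, in the form of two
  nested bisections, extends it to the whole square, whose two sides \<open>u = 0\<close> and \<open>u = 1\<close> are
  mapped to a point.
\<close>

lemma transport_homotopy:
  fixes F :: "real \<times> real \<Rightarrow> 'a"
  assumes F: "continuous_map (prod_topology (top_of_set {0..1}) (top_of_set {0..1})) X F"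
    and F0: "\<And>t. t \<in> {0..1} \<Longrightarrow> F (t, 0) = s" and F1: "\<And>t. t \<in> {0..1} \<Longrightarrow> F (t, 1) = s"
  shows "transport (\<lambda>u. F (0, u)) 0 1 = transport (\<lambda>u. F (1, u)) 0 1"
proof -
  have row: "path_on (\<lambda>u. F (t, u)) a b" if "t \<in> {0..1}" "0 \<le> a" "b \<le> 1" for t a b
  proof -
    have "path_on (F \<circ> (\<lambda>u. (t, u))) 0 1"
      using that by (intro continuous_map_compose[OF _ F]) (auto intro!: continuous_intros simp: continuous_map_pairwise o_def)
    then show ?thesis using path_on_subinterval that by (simp add: o_def)
  qed
  have col: "path_on (\<lambda>t. F (t, u)) a b" if "u \<in> {0..1}" "0 \<le> a" "b \<le> 1" for u a b
  proof -
    have "path_on (F \<circ> (\<lambda>t. (t, u))) 0 1"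
      using that by (intro continuous_map_compose[OF _ F]) (auto intro!: continuous_intros simp: continuous_map_pairwise o_def)
    then show ?thesis using path_on_subinterval that by (simp add: o_def)
  qed
  define R where "R t1 t2 a b \<longleftrightarrow>
     transport (\<lambda>u. F (t1, u)) a b \<otimes> transport (\<lambda>t. F (t, b)) t1 t2 =
     transport (\<lambda>t. F (t, a)) t1 t2 \<otimes> transport (\<lambda>u. F (t2, u)) a b" for t1 t2 a b
  have R_trans_u: "R t1 t2 a c"
    if "R t1 t2 a b" "R t1 t2 b c" "0 \<le> t1" "t1 \<le> t2" "t2 \<le> 1" "0 \<le> a" "a \<le> b" "b \<le> c" "c \<le> 1" for t1 t2 a b c
  proof -
    note cl = transport_closed[OF row] transport_closed[OF col]
    have "transport (\<lambda>u. F (t1, u)) a c = transport (\<lambda>u. F (t1, u)) a b \<otimes> transport (\<lambda>u. F (t1, u)) b c"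
      "transport (\<lambda>u. F (t2, u)) a c = transport (\<lambda>u. F (t2, u)) a b \<otimes> transport (\<lambda>u. F (t2, u)) b c"
      using that by (auto intro!: transport_trans row)
    moreover have "transport (\<lambda>u. F (t1, u)) a b \<in> carrier G" "transport (\<lambda>u. F (t1, u)) b c \<in> carrier G"
      "transport (\<lambda>u. F (t2, u)) a b \<in> carrier G" "transport (\<lambda>u. F (t2, u)) b c \<in> carrier G"
      "transport (\<lambda>t. F (t, a)) t1 t2 \<in> carrier G" "transport (\<lambda>t. F (t, b)) t1 t2 \<in> carrier G"
      "transport (\<lambda>t. F (t, c)) t1 t2 \<in> carrier G"
      using that by (auto intro!: cl)
    ultimately show ?thesis
      using commuting_squares_paste[OF that(1,2)[unfolded R_def]] unfolding R_def by simp
  qed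
  have R_trans_t: "R t1 t3 0 1" if "R t1 t2 0 1" "R t2 t3 0 1" "0 \<le> t1" "t1 \<le> t2" "t2 \<le> t3" "t3 \<le> 1" for t1 t2 t3
  proof -
    note cl = transport_closed[OF row] transport_closed[OF col]
    have "transport (\<lambda>t. F (t, u)) t1 t3 = transport (\<lambda>t. F (t, u)) t1 t2 \<otimes> transport (\<lambda>t. F (t, u)) t2 t3"
      if "u \<in> {0..1}" for u
      using that \<open>0 \<le> t1\<close> \<open>t1 \<le> t2\<close> \<open>t2 \<le> t3\<close> \<open>t3 \<le> 1\<close> by (auto intro!: transport_trans col)
    then have "transport (\<lambda>t. F (t, 0)) t1 t3 = transport (\<lambda>t. F (t, 0)) t1 t2 \<otimes> transport (\<lambda>t. F (t, 0)) t2 t3"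
      "transport (\<lambda>t. F (t, 1)) t1 t3 = transport (\<lambda>t. F (t, 1)) t1 t2 \<otimes> transport (\<lambda>t. F (t, 1)) t2 t3"
      by auto
    moreover have "transport (\<lambda>u. F (t1, u)) 0 1 \<in> carrier G" "transport (\<lambda>u. F (t2, u)) 0 1 \<in> carrier G"
      "transport (\<lambda>u. F (t3, u)) 0 1 \<in> carrier G"
      "transport (\<lambda>t. F (t, 0)) t1 t2 \<in> carrier G" "transport (\<lambda>t. F (t, 0)) t2 t3 \<in> carrier G"
      "transport (\<lambda>t. F (t, 1)) t1 t2 \<in> carrier G" "transport (\<lambda>t. F (t, 1)) t2 t3 \<in> carrier G"
      using that by (auto intro!: cl)
    ultimately show ?thesis
      using commuting_squares_paste[OF that(1,2)[unfolded R_def, symmetric]] unfolding R_def by simp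
  qed
  have R_chart: "R t1 t2 a b"
    if "k \<in> K" and inU: "\<And>t u. t1 \<le> t \<Longrightarrow> t \<le> t2 \<Longrightarrow> a \<le> u \<Longrightarrow> u \<le> b \<Longrightarrow> F (t, u) \<in> U k"
      and t: "0 \<le> t1" "t1 \<le> t2" "t2 \<le> 1" and ab: "0 \<le> a" "a \<le> b" "b \<le> 1" for t1 t2 a b k
  proof -
    have hor: "transport (\<lambda>u. F (t, u)) a b = \<tau> k (F (t, a)) \<otimes> inv\<^bsub>G\<^esub> (\<tau> k (F (t, b)))"
      if "t1 \<le> t" "t \<le> t2" for t
    proof (rule transport_in_chart[OF row ab(2) \<open>k \<in> K\<close>])
      show "t \<in> {0..1}" using that t by simp
      show "F (t, u) \<in> U k" if "a \<le> u" "u \<le> b" for u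
        by (rule inU) fact+
    qed fact+
    have ver: "transport (\<lambda>t. F (t, u)) t1 t2 = \<tau> k (F (t1, u)) \<otimes> inv\<^bsub>G\<^esub> (\<tau> k (F (t2, u)))"
      if "a \<le> u" "u \<le> b" for u
    proof (rule transport_in_chart[OF col t(2) \<open>k \<in> K\<close>])
      show "u \<in> {0..1}" using that ab by simp
      show "F (t, u) \<in> U k" if "t1 \<le> t" "t \<le> t2" for t
        by (rule inU) fact+
    qed fact+
    have "\<tau> k (F (t1, a)) \<in> carrier G" "\<tau> k (F (t1, b)) \<in> carrier G"
      "\<tau> k (F (t2, a)) \<in> carrier G" "\<tau> k (F (t2, b)) \<in> carrier G"
      by (rule frame_closed[OF \<open>k \<in> K\<close>], rule inU; use t ab in simp)+
    then show ?thesis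
      using t ab by (simp add: R_def hor ver m_assoc inv_cancel_left)
  qed
  \<comment> \<open>Bisecting in \<open>u\<close> first gives a horizontal strip of positive width around each \<open>t0\<close>.\<close>
  have strip: "\<exists>\<delta>>0. \<forall>t1 t2. 0 \<le> t1 \<and> t1 \<le> t0 \<and> t0 \<le> t2 \<and> t2 \<le> 1 \<and> t2 - t1 < \<delta> \<longrightarrow> R t1 t2 0 1"
    if t0: "0 \<le> t0" "t0 \<le> 1" for t0
  proof -
    define Q where "Q a b \<longleftrightarrow> (0 \<le> a \<longrightarrow> b \<le> 1 \<longrightarrow> (\<exists>\<delta>>0. \<forall>t1 t2. 0 \<le> t1 \<and> t1 \<le> t0 \<and> t0 \<le> t2 \<and> t2 \<le> 1 \<and> t2 - t1 < \<delta> \<longrightarrow> R t1 t2 a b))" for a b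
    have "Q 0 1"
    proof (rule Bolzano[where P = Q])
      fix a b c assume Q: "Q a b" "Q b c" and abc: "a \<le> b" "b \<le> c"
      show "Q a c"
        unfolding Q_def
      proof (intro impI)
        assume ac: "0 \<le> a" "c \<le> 1"
        obtain \<delta>1 where \<delta>1: "\<delta>1 > 0" "\<And>t1 t2. 0 \<le> t1 \<and> t1 \<le> t0 \<and> t0 \<le> t2 \<and> t2 \<le> 1 \<and> t2 - t1 < \<delta>1 \<Longrightarrow> R t1 t2 a b"
          using Q(1)[unfolded Q_def, rule_format] ac abc by (meson order_trans)
        obtain \<delta>2 where \<delta>2: "\<delta>2 > 0" "\<And>t1 t2. 0 \<le> t1 \<and> t1 \<le> t0 \<and> t0 \<le> t2 \<and> t2 \<le> 1 \<and> t2 - t1 < \<delta>2 \<Longrightarrow> R t1 t2 b c"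
          using Q(2)[unfolded Q_def, rule_format] ac abc by (meson order_trans)
        show "\<exists>\<delta>>0. \<forall>t1 t2. 0 \<le> t1 \<and> t1 \<le> t0 \<and> t0 \<le> t2 \<and> t2 \<le> 1 \<and> t2 - t1 < \<delta> \<longrightarrow> R t1 t2 a c"
        proof (intro exI[of _ "min \<delta>1 \<delta>2"] conjI allI impI)
          fix t1 t2 assume *: "0 \<le> t1 \<and> t1 \<le> t0 \<and> t0 \<le> t2 \<and> t2 \<le> 1 \<and> t2 - t1 < min \<delta>1 \<delta>2"
          show "R t1 t2 a c"
            by (rule R_trans_u[OF \<delta>1(2) \<delta>2(2)]) (use * ac abc in auto)
        qed (use \<delta>1 \<delta>2 in auto)
      qed
    next
      fix u0 :: real assume u0: "0 \<le> u0" "u0 \<le> 1"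
      have "F (t0, u0) \<in> topspace X"
        using path_on_in_topspace[OF row[of t0 0 1]] t0 u0 by auto
      then obtain k where k: "k \<in> K" "F (t0, u0) \<in> U k" using charts_cover by blast
      have "openin (top_of_set ({0..1} \<times> {0..1})) {x \<in> {0..1} \<times> {0..1}. F x \<in> U k}"
        using openin_continuous_map_preimage[OF F open_chart[OF k(1)]]
        by (simp add: prod_topology_subtopology subtopology_subtopology Times_Int_Times flip: euclidean_product_topology)
      moreover have "(t0, u0) \<in> {x \<in> {0..1} \<times> {0..1}. F x \<in> U k}" using t0 u0 k by auto
      ultimately obtain e where e: "e > 0"
        "\<And>x. x \<in> {0..1} \<times> {0..1} \<Longrightarrow> dist x (t0, u0) < e \<Longrightarrow> F x \<in> U k"
        unfolding openin_euclidean_subtopology_iff by (smt (verit) mem_Collect_eq)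
      have near: "F (t, u) \<in> U k" if "t \<in> {0..1}" "u \<in> {0..1}" "\<bar>t - t0\<bar> < e/2" "\<bar>u - u0\<bar> < e/2" for t u
      proof (rule e(2))
        have "dist (t, u) (t0, u0) \<le> \<bar>t - t0\<bar> + \<bar>u - u0\<bar>"
          unfolding dist_Pair_Pair dist_real_def by (rule sqrt_sum_squares_le_sum) auto
        then show "dist (t, u) (t0, u0) < e" using that by linarith
      qed (use that in auto)
      show "\<exists>d>0. \<forall>a b. a \<le> u0 \<and> u0 \<le> b \<and> b - a < d \<longrightarrow> Q a b"
      proof (intro exI[of _ "e/2"] conjI allI impI)
        fix a b assume ab: "a \<le> u0 \<and> u0 \<le> b \<and> b - a < e/2"
        show "Q a b"
          unfolding Q_def
        proof (intro impI exI[of _ "e/2"] conjI allI)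
          fix t1 t2 assume *: "0 \<le> a" "b \<le> 1" "0 \<le> t1 \<and> t1 \<le> t0 \<and> t0 \<le> t2 \<and> t2 \<le> 1 \<and> t2 - t1 < e/2"
          show "R t1 t2 a b"
          proof (rule R_chart[OF k(1)])
            show "F (t, u) \<in> U k" if "t1 \<le> t" "t \<le> t2" "a \<le> u" "u \<le> b" for t u
            proof (rule near)
              show "\<bar>t - t0\<bar> < e/2" using that * by linarith
              show "\<bar>u - u0\<bar> < e/2" using that ab by linarith
            qed (use that * in auto)
          qed (use ab * in auto)
        qed (use e in auto)
      qed (use e in auto)
    qed auto
    then show ?thesis by (simp add: Q_def)
  qed
  \<comment> \<open>Bisecting in \<open>t\<close> stacks the strips.\<close>
  have "0 \<le> (0::real) \<longrightarrow> 1 \<le> (1::real) \<longrightarrow> R 0 1 0 1"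
  proof (rule Bolzano[where P = "\<lambda>t1 t2. 0 \<le> t1 \<longrightarrow> t2 \<le> 1 \<longrightarrow> R t1 t2 0 1"])
    show "0 \<le> a \<longrightarrow> c \<le> 1 \<longrightarrow> R a c 0 1"
      if "0 \<le> a \<longrightarrow> b \<le> 1 \<longrightarrow> R a b 0 1" "0 \<le> b \<longrightarrow> c \<le> 1 \<longrightarrow> R b c 0 1" "a \<le> b" "b \<le> c" for a b c
      using that R_trans_t[of a b c] by auto
    show "\<exists>d>0. \<forall>a b. a \<le> x \<and> x \<le> b \<and> b - a < d \<longrightarrow> 0 \<le> a \<longrightarrow> b \<le> 1 \<longrightarrow> R a b 0 1"
      if "0 \<le> x" "x \<le> 1" for x
      using strip[OF that] by blast
  qed auto
  then have "R 0 1 0 1" by simp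
  moreover have "s \<in> topspace X" using path_on_in_topspace[OF row[of 0 0 1], of 0] F0[of 0] by simp
  moreover have "transport (\<lambda>t. F (t, u)) 0 1 = \<one>" if "u = 0 \<or> u = 1" for u
  proof -
    have "transport (\<lambda>t. F (t, u)) 0 1 = transport (\<lambda>_. s) (1 * 0 + 0) (1 * 1 + 0)"
      using that F0 F1 \<open>s \<in> topspace X\<close> by (intro transport_reparametrize col) auto
    then show ?thesis using transport_constant[OF \<open>s \<in> topspace X\<close>] by simp
  qed
  ultimately show ?thesis
    using transport_closed[OF row[of 0 0 1]] transport_closed[OF row[of 1 0 1]] by (simp add: R_def)
qed

definition holonomy :: "(real \<Rightarrow> 'a) set \<Rightarrow> 'b" where
  "holonomy C = transport (SOME g. g \<in> C) 0 1"

lemma holonomy_eqI: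
  assumes "C \<noteq> {}" "\<And>g. g \<in> C \<Longrightarrow> transport g 0 1 = x"
  shows "holonomy C = x"
  unfolding holonomy_def by (rule assms(2)) (use assms(1) in \<open>simp add: some_in_eq\<close>)

lemma transport_homotopic_loops:
  assumes "homotopic_loops_at X s g h"
  shows "transport g 0 1 = transport h 0 1"
proof -
  obtain F :: "real \<times> real \<Rightarrow> 'a" where F: "continuous_map (prod_topology (top_of_set {0..1}) (top_of_set {0..1})) X F"
    "\<And>u. F (0, u) = g u" "\<And>u. F (1, u) = h u" "\<And>t. t \<in> {0..1} \<Longrightarrow> F (t, 0) = s \<and> F (t, 1) = s"
    using assms unfolding homotopic_loops_at_def homotopic_with_def by blast
  have "transport (\<lambda>u. F (0, u)) 0 1 = transport (\<lambda>u. F (1, u)) 0 1"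
    using F by (intro transport_homotopy[where s = s]) auto
  then show ?thesis by (simp add: F)
qed

lemma loop_in_own_class: "g \<in> loops X s \<Longrightarrow> g \<in> loop_class X s g"
  by (simp add: loop_class_def homotopic_loops_at_def loops_def pathin_def)

lemma transport_on_loop_class: "h \<in> loop_class X s g \<Longrightarrow> transport h 0 1 = transport g 0 1"
  using transport_homotopic_loops[of s g h] by (simp add: loop_class_def)

lemma holonomy_loop_class: "g \<in> loops X s \<Longrightarrow> holonomy (loop_class X s g) = transport g 0 1"
  by (rule holonomy_eqI) (use loop_in_own_class in blast, rule transport_on_loop_class)

text \<open>
  The product of two homotopy classes is a union of classes of concatenations. Transport takes the
  same value on all members of that union, so the choice of a representative in \<open>holonomy\<close> is
  immaterial.
\<close>

theorem holonomy_hom: "holonomy \<in> hom (fundamental_group X s) G"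
proof (rule homI)
  fix C assume "C \<in> carrier (fundamental_group X s)"
  then obtain g where "g \<in> loops X s" "C = loop_class X s g" by (auto simp: fundamental_group_def)
  then show "holonomy C \<in> carrier G"
    using transport_closed[where g = g and a = 0 and b = 1] by (simp add: holonomy_loop_class loops_def pathin_def)
next
  fix C D assume "C \<in> carrier (fundamental_group X s)" "D \<in> carrier (fundamental_group X s)"
  then obtain g h where g: "g \<in> loops X s" "C = loop_class X s g" and h: "h \<in> loops X s" "D = loop_class X s h"
    by (auto simp: fundamental_group_def)
  have concat: "concat_loops g' h' \<in> loops X s" "transport (concat_loops g' h') 0 1 = transport g' 0 1 \<otimes> transport h' 0 1"
    if "g' \<in> loops X s" "h' \<in> loops X s" for g' h'
    using that pathin_concat[of g' h'] transport_concat[of g' h'] by (auto simp: loops_def) (auto simp: concat_loops_def)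
  have "holonomy (\<Union>g'\<in>C. \<Union>h'\<in>D. loop_class X s (concat_loops g' h')) = holonomy C \<otimes> holonomy D"
  proof (rule holonomy_eqI)
    show "(\<Union>g'\<in>C. \<Union>h'\<in>D. loop_class X s (concat_loops g' h')) \<noteq> {}"
      using loop_in_own_class[OF concat(1)[OF g(1) h(1)]] loop_in_own_class[OF g(1)] loop_in_own_class[OF h(1)] g h by auto
    fix f assume "f \<in> (\<Union>g'\<in>C. \<Union>h'\<in>D. loop_class X s (concat_loops g' h'))"
    then obtain g' h' where *: "g' \<in> C" "h' \<in> D" "f \<in> loop_class X s (concat_loops g' h')" by auto
    then have "g' \<in> loops X s" "h' \<in> loops X s" using g h by (auto simp: loop_class_def)
    then show "transport f 0 1 = holonomy C \<otimes> holonomy D"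
      using * transport_on_loop_class[OF *(3)] concat(2) g h transport_on_loop_class[of g' s g] transport_on_loop_class[of h' s h]
      by (simp add: holonomy_loop_class)
  qed
  then show "holonomy (C \<otimes>\<^bsub>fundamental_group X s\<^esub> D) = holonomy C \<otimes> holonomy D"
    by (simp add: fundamental_group_def)
qed

lemma holonomy_image: "holonomy ` carrier (fundamental_group X s) = (\<lambda>g. transport g 0 1) ` loops X s"
proof -
  have "carrier (fundamental_group X s) = loop_class X s ` loops X s"
    by (simp add: fundamental_group_def)
  then show ?thesis
    by (simp only: image_image) (rule image_cong[OF refl holonomy_loop_class])
qed

end

section \<open>The group of real two-by-two matrices of determinant one\<close>

definition mat2 :: "real \<Rightarrow> real \<Rightarrow> real \<Rightarrow> real \<Rightarrow> real mat" where
  "mat2 a b c d = mat 2 2 (\<lambda>(i, j). if i = 0 then if j = 0 then a else b else if j = 0 then c else d)"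

lemma mat2_carrier [simp]: "mat2 a b c d \<in> carrier_mat 2 2"
  by (simp add: mat2_def)

lemma mat2_entries [simp]:
  "mat2 a b c d $$ (0, 0) = a" "mat2 a b c d $$ (0, Suc 0) = b"
  "mat2 a b c d $$ (Suc 0, 0) = c" "mat2 a b c d $$ (Suc 0, Suc 0) = d"
  by (simp_all add: mat2_def)

lemma mat2_eqI:
  assumes "A \<in> carrier_mat 2 2" "B \<in> carrier_mat 2 2" "A $$ (0, 0) = B $$ (0, 0)"
    "A $$ (0, Suc 0) = B $$ (0, Suc 0)" "A $$ (Suc 0, 0) = B $$ (Suc 0, 0)" "A $$ (Suc 0, Suc 0) = B $$ (Suc 0, Suc 0)"
  shows "A = B"
proof (rule eq_matI)
  fix i j assume "i < dim_row B" "j < dim_col B"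
  then have "i = 0 \<or> i = Suc 0" "j = 0 \<or> j = Suc 0" using assms(2) by auto
  then show "A $$ (i, j) = B $$ (i, j)" using assms by auto
qed (use assms in auto)

lemma mat2_exhaust:
  assumes "A \<in> carrier_mat 2 2"
  obtains a b c d where "A = mat2 a b c d"
proof
  show "A = mat2 (A $$ (0, 0)) (A $$ (0, Suc 0)) (A $$ (Suc 0, 0)) (A $$ (Suc 0, Suc 0))"
    using assms by (intro mat2_eqI) auto
qed

lemma mat2_eq_iff [simp]:
  "mat2 a b c d = mat2 a' b' c' d' \<longleftrightarrow> a = a' \<and> b = b' \<and> c = c' \<and> d = d'"
  by (metis mat2_entries)

lemma mat2_mult [simp]:
  "mat2 a b c d * mat2 a' b' c' d' =
     mat2 (a * a' + b * c') (a * b' + b * d') (c * a' + d * c') (c * b' + d * d')"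
  by (rule mat2_eqI) (auto simp: scalar_prod_def mat2_def numeral_2_eq_2)

lemma one_mat2: "1\<^sub>m 2 = mat2 1 0 0 1"
  by (rule mat2_eqI) auto

definition SL2 :: "real mat set" where
  "SL2 = {mat2 a b c d | a b c d. a * d - b * c = 1}"

abbreviation upper :: "real \<Rightarrow> real mat" where
  "upper x \<equiv> mat2 1 x 0 1"

abbreviation lower :: "real \<Rightarrow> real mat" where
  "lower x \<equiv> mat2 1 0 x 1"

lemma mat2_in_SL2 [simp]: "mat2 a b c d \<in> SL2 \<longleftrightarrow> a * d - b * c = 1"
  by (auto simp: SL2_def)

lemma SL2_E:
  assumes "A \<in> SL2"
  obtains a b c d where "A = mat2 a b c d" "a * d - b * c = 1"
  using assms by (auto simp: SL2_def)

lemma SL2_carrier: "A \<in> SL2 \<Longrightarrow> A \<in> carrier_mat 2 2"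
  by (auto simp: SL2_def)

lemma SL2_elementary_lower_left:
  assumes "a * d - b * c = 1" "c \<noteq> 0"
  shows "mat2 a b c d = upper ((a - 1) / c) * (lower c * upper ((d - 1) / c))"
proof -
  have b: "b = (a * d - 1) / c" using assms by (simp add: field_simps)
  show ?thesis unfolding b using assms(2) by (simp add: field_simps)
qed

text \<open>
  If the lower left entry vanishes, the factorization with three factors is applied after a column
  operation, which turns that entry into the negative of the lower right one.
\<close>

lemma SL2_elementary:
  assumes "A \<in> SL2"
  obtains x y z w where "A = upper x * (lower y * (upper z * lower w))"
proof -
  obtain a b c d where A: "A = mat2 a b c d" "a * d - b * c = 1"
    using assms by (rule SL2_E)
  show thesis
  proof (cases "c = 0")
    case False
    then show thesis
      using that[of "(a - 1) / c" c "(d - 1) / c" 0] A SL2_elementary_lower_left[OF A(2) False] by simp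
  next
    case True
    then have "- d \<noteq> 0" using A by auto
    moreover have "(a - b) * d - b * (- d) = 1" using A True by (simp add: algebra_simps)
    ultimately have "mat2 (a - b) b (- d) d =
        upper ((a - b - 1) / (- d)) * (lower (- d) * upper ((d - 1) / (- d)))"
      by (intro SL2_elementary_lower_left) auto
    moreover have "A = mat2 (a - b) b (- d) d * lower 1" using A True by simp
    ultimately have "A = upper ((a - b - 1) / (- d)) * (lower (- d) * (upper ((d - 1) / (- d)) * lower 1))"
      by (simp only: assoc_mult_mat[of _ 2 2 _ 2 _ 2] mat2_carrier mult_carrier_mat[of _ 2 2 _ 2])
    then show thesis by (rule that)
  qed
qed

subsection \<open>As a real algebraic group\<close>

lemma general_linear_group_simps [simp]:
  "mult (general_linear_group N) = (*)" "one (general_linear_group N) = 1\<^sub>m N"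
  by (simp_all add: general_linear_group_def units_of_def ring_mat_simps)

lemma group_general_linear_group: "Group.group (general_linear_group N)"
proof -
  interpret ring "ring_mat TYPE(real) N ()" by (rule ring_mat)
  show ?thesis unfolding general_linear_group_def by (rule units_group)
qed

lemma general_linear_group_carrier: "A \<in> carrier (general_linear_group N) \<Longrightarrow> A \<in> carrier_mat N N"
  by (auto simp: general_linear_group_def units_of_def Units_def ring_mat_simps)

lemma SL2_inverse:
  assumes "a * d - b * c = 1"
  shows "mat2 d (- b) (- c) a * mat2 a b c d = 1\<^sub>m 2" "mat2 a b c d * mat2 d (- b) (- c) a = 1\<^sub>m 2"
  using assms by (simp_all add: one_mat2 algebra_simps)

lemma SL2_subset_GL2: "SL2 \<subseteq> carrier (general_linear_group 2)"
proof
  fix A assume "A \<in> SL2"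
  then obtain a b c d where A: "A = mat2 a b c d" "a * d - b * c = 1"
    by (rule SL2_E)
  then show "A \<in> carrier (general_linear_group 2)"
    using SL2_inverse[OF A(2)] unfolding general_linear_group_def units_of_def Units_def
    by (auto simp: ring_mat_simps simp del: mat2_mult intro!: bexI[of _ "mat2 d (- b) (- c) a"])
qed

lemma SL2_inv:
  assumes "a * d - b * c = 1"
  shows "inv\<^bsub>general_linear_group 2\<^esub> (mat2 a b c d) = mat2 d (- b) (- c) a"
proof (rule group.inv_equality[OF group_general_linear_group])
  have "mat2 a b c d \<in> SL2" "mat2 d (- b) (- c) a \<in> SL2" using assms by (auto simp: algebra_simps)
  then show "mat2 a b c d \<in> carrier (general_linear_group 2)" "mat2 d (- b) (- c) a \<in> carrier (general_linear_group 2)"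
    using SL2_subset_GL2 by auto
  show "mat2 d (- b) (- c) a \<otimes>\<^bsub>general_linear_group 2\<^esub> mat2 a b c d = \<one>\<^bsub>general_linear_group 2\<^esub>"
    using SL2_inverse[OF assms] by simp
qed

lemma SL2_mult_closed: "A \<in> SL2 \<Longrightarrow> B \<in> SL2 \<Longrightarrow> A * B \<in> SL2"
proof (elim SL2_E)
  fix a b c d a' b' c' d'
  assume AB: "A = mat2 a b c d" "a * d - b * c = 1" "B = mat2 a' b' c' d'" "a' * d' - b' * c' = 1"
  have "(a * a' + b * c') * (c * b' + d * d') - (a * b' + b * d') * (c * a' + d * c') =
      (a * d - b * c) * (a' * d' - b' * c')"
    by (simp add: algebra_simps)
  then show "A * B \<in> SL2" using AB by simp
qed

lemma subgroup_SL2: "subgroup SL2 (general_linear_group 2)"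
proof (rule subgroup.intro)
  show "SL2 \<subseteq> carrier (general_linear_group 2)" by (rule SL2_subset_GL2)
  show "A \<otimes>\<^bsub>general_linear_group 2\<^esub> B \<in> SL2" if "A \<in> SL2" "B \<in> SL2" for A B
    using SL2_mult_closed[OF that] by simp
  show "\<one>\<^bsub>general_linear_group 2\<^esub> \<in> SL2" by (simp add: one_mat2)
  show "inv\<^bsub>general_linear_group 2\<^esub> A \<in> SL2" if "A \<in> SL2" for A
    using that by (elim SL2_E) (simp add: SL2_inv mult.commute)
qed

abbreviation SL2_group :: "real mat monoid" where
  "SL2_group \<equiv> general_linear_group 2\<lparr>carrier := SL2\<rparr>"

lemma group_SL2: "Group.group SL2_group"
  using subgroup.subgroup_is_group[OF subgroup_SL2 group_general_linear_group] .

lemma SL2_group_inv: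
  assumes "a * d - b * c = 1"
  shows "inv\<^bsub>SL2_group\<^esub> (mat2 a b c d) = mat2 d (- b) (- c) a"
  using group.m_inv_consistent[OF group_general_linear_group subgroup_SL2, of "mat2 a b c d"] assms SL2_inv
  by simp

lemma topspace_zariski: "topspace (zariski_topology N) = carrier (general_linear_group N)"
proof -
  have "polynomial_in_entries N (\<lambda>_. 1)" by (rule polynomial_in_entries.const)
  then have "carrier (general_linear_group N) \<in>
      {{A \<in> carrier (general_linear_group N). p A \<noteq> 0} | p. polynomial_in_entries N p}"
    by (intro CollectI exI[of _ "\<lambda>_. 1"]) simp
  then have "carrier (general_linear_group N) \<subseteq>
      \<Union> {{A \<in> carrier (general_linear_group N). p A \<noteq> 0} | p. polynomial_in_entries N p}"
    by (rule Union_upper)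
  then show ?thesis by (auto simp: zariski_topology_def)
qed

lemma zariski_openin_basic:
  "polynomial_in_entries N p \<Longrightarrow> openin (zariski_topology N) {A \<in> carrier (general_linear_group N). p A \<noteq> 0}"
  unfolding zariski_topology_def by (rule topology_generated_by_Basis) auto

text \<open>
  The sets where one polynomial does not vanish are a basis and not just a subbasis, because the
  intersection of two of them belongs to the product polynomial.
\<close>

lemma zariski_basis:
  assumes "openin (zariski_topology N) T" "A \<in> T"
  obtains p where "polynomial_in_entries N p" "p A \<noteq> 0"
    "\<And>B. B \<in> carrier (general_linear_group N) \<Longrightarrow> p B \<noteq> 0 \<Longrightarrow> B \<in> T"
proof -
  have "generate_topology_on {{A \<in> carrier (general_linear_group N). p A \<noteq> 0} | p. polynomial_in_entries N p} T"
    using assms(1) by (simp add: zariski_topology_def openin_topology_generated_by_iff)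
  then have "A \<in> T \<Longrightarrow> \<exists>p. polynomial_in_entries N p \<and> p A \<noteq> 0 \<and>
      (\<forall>B \<in> carrier (general_linear_group N). p B \<noteq> 0 \<longrightarrow> B \<in> T)"
  proof induction
    case (Int S T)
    then obtain p q where
      "polynomial_in_entries N p" "p A \<noteq> 0" "\<forall>B \<in> carrier (general_linear_group N). p B \<noteq> 0 \<longrightarrow> B \<in> S"
      "polynomial_in_entries N q" "q A \<noteq> 0" "\<forall>B \<in> carrier (general_linear_group N). q B \<noteq> 0 \<longrightarrow> B \<in> T"
      by blast
    then show ?case
      by (intro exI[of _ "\<lambda>A. p A * q A"]) (auto intro: polynomial_in_entries.mult)
  qed blast+
  then show thesis using that assms(2) by blast
qed

lemma zariski_closed_SL2: "closedin (zariski_topology 2) SL2"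
proof -
  define p :: "real mat \<Rightarrow> real" where
    "p = (\<lambda>A. (A $$ (0, 0) * A $$ (1, 1) + (-1) * (A $$ (0, 1) * A $$ (1, 0))) + (-1))"
  have "polynomial_in_entries 2 p"
    unfolding p_def by (intro polynomial_in_entries.intros) auto
  moreover have "topspace (zariski_topology 2) - SL2 = {A \<in> carrier (general_linear_group 2). p A \<noteq> 0}"
  proof -
    have "A \<in> SL2 \<longleftrightarrow> p A = 0" if A: "A \<in> carrier (general_linear_group 2)" for A
    proof -
      obtain a b c d where "A = mat2 a b c d"
        using mat2_exhaust[OF general_linear_group_carrier[OF A]] by metis
      then show ?thesis by (auto simp: p_def)
    qed
    then show ?thesis by (auto simp: topspace_zariski)
  qed
  ultimately show ?thesis
    using SL2_subset_GL2 by (simp add: closedin_def topspace_zariski zariski_openin_basic)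
qed

lemma continuous_on_polynomial_in_entries:
  fixes M :: "'a::topological_space \<Rightarrow> real mat"
  assumes "polynomial_in_entries N p" "\<And>i j. i < N \<Longrightarrow> j < N \<Longrightarrow> continuous_on S (\<lambda>x. M x $$ (i, j))"
  shows "continuous_on S (\<lambda>x. p (M x))"
  using assms by induction (auto intro!: continuous_intros)

text \<open>
  By \<open>SL2_elementary\<close> the group is the image of four-dimensional real space under a polynomial
  map, and such a map is continuous from the Euclidean to the Zariski topology.
\<close>

lemma connectedin_zariski_SL2: "connectedin (zariski_topology 2) SL2"
proof -
  define M :: "real \<times> real \<times> real \<times> real \<Rightarrow> real mat" where
    "M = (\<lambda>(x, y, z, w). upper x * (lower y * (upper z * lower w)))"
  have M_SL2: "M v \<in> SL2" for v
    by (auto simp: M_def case_prod_unfold algebra_simps)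
  have "continuous_map euclidean (zariski_topology 2) M"
    unfolding zariski_topology_def continuous_on_generated_topo_iff
  proof (intro conjI allI impI)
    show "M ` topspace euclidean \<subseteq> \<Union> {{A \<in> carrier (general_linear_group 2). p A \<noteq> 0} |p. polynomial_in_entries 2 p}"
      using M_SL2 SL2_subset_GL2 topspace_zariski[of 2] by (auto simp: zariski_topology_def)
    fix V assume "V \<in> {{A \<in> carrier (general_linear_group 2). p A \<noteq> 0} |p. polynomial_in_entries 2 p}"
    then obtain p where p: "polynomial_in_entries 2 p" and V: "V = {A \<in> carrier (general_linear_group 2). p A \<noteq> 0}"
      by blast
    have "continuous_on UNIV (\<lambda>v. p (M v))"
    proof (rule continuous_on_polynomial_in_entries[OF p])
      fix i j :: nat assume "i < 2" "j < 2"
      then have "i = 0 \<or> i = Suc 0" "j = 0 \<or> j = Suc 0" by auto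
      then show "continuous_on UNIV (\<lambda>v. M v $$ (i, j))"
        by (auto simp: M_def case_prod_unfold intro!: continuous_intros)
    qed
    then have "open ((\<lambda>v. p (M v)) -` (- {0}))"
      by (intro open_vimage) auto
    moreover have "M -` V = (\<lambda>v. p (M v)) -` (- {0})"
      using M_SL2 SL2_subset_GL2 by (auto simp: V)
    ultimately show "openin euclidean (M -` V \<inter> topspace euclidean)" by simp
  qed
  then have "connectedin (zariski_topology 2) (M ` UNIV)"
    by (rule connectedin_continuous_map_image) auto
  moreover have "M ` UNIV = SL2"
  proof
    show "M ` UNIV \<subseteq> SL2" using M_SL2 by auto
    show "SL2 \<subseteq> M ` UNIV"
    proof
      fix A assume "A \<in> SL2"
      then obtain x y z w where "A = upper x * (lower y * (upper z * lower w))" by (rule SL2_elementary)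
      then have "A = M (x, y, z, w)" by (simp add: M_def)
      then show "A \<in> M ` UNIV" by blast
    qed
  qed
  ultimately show ?thesis by simp
qed

text \<open>
  The upper right entry is continuous and unbounded on the group.
\<close>

lemma not_compact_SL2: "\<not> compactin (euclidean_mat_topology 2) SL2"
proof
  assume *: "compactin (euclidean_mat_topology 2) SL2"
  have "continuous_map (product_topology (\<lambda>_. euclideanreal) ({..<2} \<times> {..<2})) euclideanreal (\<lambda>x. x (0::nat, 1::nat))"
    by (rule continuous_map_product_projection) auto
  then have "continuous_map (euclidean_mat_topology 2) euclideanreal
      ((\<lambda>x. x (0, 1)) \<circ> (\<lambda>A. \<lambda>ij \<in> {..<2} \<times> {..<2}. A $$ ij))"
    unfolding euclidean_mat_topology_def by (rule continuous_map_pullback)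
  then have "compactin euclideanreal (((\<lambda>x. x (0, 1)) \<circ> (\<lambda>A. \<lambda>ij \<in> {..<2} \<times> {..<2}. A $$ ij)) ` SL2)"
    by (rule image_compactin[OF *])
  moreover have "x \<in> ((\<lambda>x. x (0, 1)) \<circ> (\<lambda>A. \<lambda>ij \<in> {..<2} \<times> {..<2}. A $$ ij)) ` SL2" for x :: real
    by (rule image_eqI[of _ _ "upper x"]) auto
  then have "((\<lambda>x. x (0, 1)) \<circ> (\<lambda>A. \<lambda>ij \<in> {..<2} \<times> {..<2}. A $$ ij)) ` SL2 = (UNIV :: real set)"
    by blast
  ultimately have "compact (UNIV :: real set)" by simp
  then show False by simp
qed

subsection \<open>Semisimplicity\<close>

lemma SL2_conj_closed:
  assumes "R \<lhd> SL2_group" "mat2 a b c d \<in> R" "p * s - q * r = 1"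
  shows "mat2 p q r s * mat2 a b c d * mat2 s (- q) (- r) p \<in> R"
  using normal.inv_op_closed2[OF assms(1), of "mat2 p q r s" "mat2 a b c d"] assms
  by (simp add: SL2_group_inv del: mat2_mult)

lemma SL2_normal_mult_closed: "R \<lhd> SL2_group \<Longrightarrow> A \<in> R \<Longrightarrow> B \<in> R \<Longrightarrow> A * B \<in> R"
  using subgroup.m_closed[OF normal_imp_subgroup, of R SL2_group A B] by simp

lemma SL2_normal_subset: "R \<lhd> SL2_group \<Longrightarrow> R \<subseteq> SL2"
  using subgroup.subset[OF normal_imp_subgroup, of R SL2_group] by simp

lemma SL2_normal_inv:
  assumes "R \<lhd> SL2_group" "mat2 a b c d \<in> R"
  shows "mat2 d (- b) (- c) a \<in> R"
proof -
  have "a * d - b * c = 1" using SL2_normal_subset assms by fastforce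
  then show ?thesis
    using subgroup.m_inv_closed[OF normal_imp_subgroup, of R SL2_group "mat2 a b c d"] assms
    by (simp add: SL2_group_inv)
qed

lemma SL2_contains_unipotents:
  assumes R: "subgroup R SL2_group" and u: "\<And>x. upper x \<in> R" and l: "\<And>x. lower x \<in> R"
  shows "R = SL2"
proof
  show "R \<subseteq> SL2" using subgroup.subset[OF R] by simp
  have cl: "A * B \<in> R" if "A \<in> R" "B \<in> R" for A B
    using subgroup.m_closed[OF R that] by simp
  show "SL2 \<subseteq> R"
  proof
    fix A assume "A \<in> SL2"
    then obtain x y z w where "A = upper x * (lower y * (upper z * lower w))" by (rule SL2_elementary)
    then show "A \<in> R" using cl u l by metis
  qed
qed

text \<open>
  Conjugation produces an element of \<open>R\<close> with vanishing upper left entry. Its commutator with a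
  diagonal matrix is lower triangular with unequal diagonal entries, and the commutators of the
  latter with the lower unipotent matrices are all the lower unipotent matrices.
\<close>

lemma SL2_noncentral_normal:
  assumes R: "R \<lhd> SL2_group" and A: "mat2 a b c d \<in> R" and noncentral: "\<not> (b = 0 \<and> c = 0 \<and> a = d)"
  shows "R = SL2"
proof -
  have det: "a * d - b * c = 1" if "mat2 a b c d \<in> R" for a b c d
    using SL2_normal_subset[OF R] that by fastforce
  obtain a' b' c' d' where A': "mat2 a' b' c' d' \<in> R" "c' \<noteq> 0"
  proof (cases "c = 0")
    case False
    then show thesis using that A by blast
  next
    case c: True
    show thesis
    proof (cases "b = 0")
      case False
      have "mat2 0 1 (- 1) 0 * mat2 a b c d * mat2 0 (- 1) (- (- 1)) 0 \<in> R"
        by (rule SL2_conj_closed[OF R A]) simp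
      then have "mat2 d (- c) (- b) a \<in> R" by simp
      then show thesis using that False by fastforce
    next
      case True
      then have "a \<noteq> d" using c noncentral by simp
      have "lower 1 * mat2 a b c d * mat2 1 (- 0) (- 1) 1 \<in> R"
        by (rule SL2_conj_closed[OF R A]) simp
      then have "mat2 a 0 (a - d) d \<in> R" using c True by simp
      then show thesis using that \<open>a \<noteq> d\<close> by fastforce
    qed
  qed
  define t where "t = a' + d'"
  \<comment> \<open>Conjugation by \<open>upper x\<close> adds \<open>x\<close> times the second row to the first, then changes the second column only.\<close>
  have B: "mat2 0 (- 1 / c') c' t \<in> R"
  proof -
    have "upper (- a' / c') * mat2 a' b' c' d' * mat2 1 (- (- a' / c')) (- 0) 1 \<in> R"
      by (rule SL2_conj_closed[OF R A'(1)]) simp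
    moreover have "upper (- a' / c') * mat2 a' b' c' d' * mat2 1 (- (- a' / c')) (- 0) 1 = mat2 0 (- 1 / c') c' t"
      using A'(2) det[OF A'(1)] by (simp add: t_def field_simps)
    ultimately show ?thesis by metis
  qed
  \<comment> \<open>The commutator with the diagonal matrix with entries \<open>2\<close> and \<open>1/2\<close>.\<close>
  have C: "mat2 4 0 (c' * t / 4 - c' * t) (1 / 4) \<in> R"
  proof -
    have "mat2 2 0 0 (1/2) * mat2 0 (- 1 / c') c' t * mat2 (1/2) (- 0) (- 0) 2 \<in> R"
      by (rule SL2_conj_closed[OF R B]) simp
    then have "(mat2 2 0 0 (1/2) * mat2 0 (- 1 / c') c' t * mat2 (1/2) (- 0) (- 0) 2) * mat2 t (- (- 1 / c')) (- c') 0 \<in> R"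
      using SL2_normal_inv[OF R B] SL2_normal_mult_closed[OF R] by blast
    moreover have "(mat2 2 0 0 (1/2) * mat2 0 (- 1 / c') c' t * mat2 (1/2) (- 0) (- 0) 2) * mat2 t (- (- 1 / c')) (- c') 0 =
        mat2 4 0 (c' * t / 4 - c' * t) (1 / 4)"
      using A'(2) by (simp add: field_simps)
    ultimately show ?thesis by metis
  qed
  have l: "lower y \<in> R" for y
  proof -
    \<comment> \<open>Conjugation by the triangular matrix divides the entry of \<open>lower x\<close> by 16, so the commutator is \<open>lower (x - x / 16)\<close>.\<close>
    define x where "x = 16 * y / 15"
    define w where "w = c' * t / 4 - c' * t"
    have C': "mat2 4 0 w (1/4) \<in> R" using C by (simp add: w_def)
    have "lower x * mat2 4 0 w (1/4) * mat2 1 (- 0) (- x) 1 \<in> R"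
      by (rule SL2_conj_closed[OF R C']) simp
    then have "(lower x * mat2 4 0 w (1/4) * mat2 1 (- 0) (- x) 1) * mat2 (1/4) (- 0) (- w) 4 \<in> R"
      using SL2_normal_inv[OF R C'] SL2_normal_mult_closed[OF R] by blast
    moreover have "(lower x * mat2 4 0 w (1/4) * mat2 1 (- 0) (- x) 1) * mat2 (1/4) (- 0) (- w) 4 = lower y"
      by (simp add: x_def field_simps)
    ultimately show ?thesis by metis
  qed
  have u: "upper y \<in> R" for y
  proof -
    have "mat2 0 1 (- 1) 0 * lower (- y) * mat2 0 (- 1) (- (- 1)) 0 \<in> R"
      by (rule SL2_conj_closed[OF R l]) simp
    then show ?thesis by simp
  qed
  show ?thesis
    by (rule SL2_contains_unipotents[OF normal_imp_subgroup[OF R] u l])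
qed

text \<open>
  Conjugation by the diagonal matrix with entries \<open>2\<close> and \<open>1/2\<close> multiplies the parameter of
  \<open>upper\<close> by 4 and divides that of \<open>lower\<close> by 4. So every unipotent matrix of these two kinds is a
  commutator.
\<close>

lemma SL2_perfect: "derived SL2_group SL2 = SL2"
proof (rule SL2_contains_unipotents)
  interpret Group.group SL2_group by (rule group_SL2)
  have SL2: "SL2 = carrier SL2_group" by simp
  show "subgroup (derived SL2_group SL2) SL2_group"
    using derived_is_subgroup[of "carrier SL2_group"] by simp
  have comm: "mat2 2 0 0 (1/2) * A * mat2 (1/2) (- 0) (- 0) 2 * B \<in> derived SL2_group SL2"
    if "A \<in> SL2" "inv\<^bsub>SL2_group\<^esub> A = B" for A B
  proof -
    have "mat2 2 0 0 (1/2) \<otimes>\<^bsub>SL2_group\<^esub> A \<otimes>\<^bsub>SL2_group\<^esub> inv\<^bsub>SL2_group\<^esub> (mat2 2 0 0 (1/2)) \<otimes>\<^bsub>SL2_group\<^esub> inv\<^bsub>SL2_group\<^esub> A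
        \<in> derived SL2_group SL2"
      unfolding derived_def using that by (intro generate.incl UN_I[of "mat2 2 0 0 (1/2)"] UN_I[of A]) auto
    then show ?thesis using that SL2_group_inv[of 2 "1/2" 0 0] by simp
  qed
  show "upper x \<in> derived SL2_group SL2" for x
    using comm[of "upper (x / 3)" "mat2 1 (- (x / 3)) (- 0) 1"] SL2_group_inv[of 1 1 "x / 3" 0] by simp
  show "lower x \<in> derived SL2_group SL2" for x
    using comm[of "lower (- 4 * x / 3)" "mat2 1 (- 0) (- (- 4 * x / 3)) 1"] SL2_group_inv[of 1 1 0 "- 4 * x / 3"] by simp
qed

lemma not_solvable_SL2: "\<not> solvable SL2_group"
proof
  interpret Group.group SL2_group by (rule group_SL2)
  assume "solvable SL2_group"
  then obtain n where "(derived SL2_group ^^ n) SL2 = {\<one>\<^bsub>SL2_group\<^esub>}"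
    using solvable_imp_trivial_derived_seq[of SL2] by (auto simp: solvable_def)
  moreover have "(derived SL2_group ^^ n) SL2 = SL2"
    by (induction n) (simp_all add: SL2_perfect)
  ultimately have eq: "SL2 = {1\<^sub>m 2}" by simp
  have "upper 1 \<in> SL2" by simp
  then show False unfolding eq by (simp add: one_mat2)
qed

text \<open>
  A proper normal subgroup is central, hence contained in the group of plus and minus the identity
  matrix; that group is finite, so its connected subgroups are trivial. The whole group is not
  solvable, as it is perfect.
\<close>

theorem semisimple_SL2: "semisimple_real_algebraic_group 2 SL2"
  unfolding semisimple_real_algebraic_group_def real_algebraic_group_def
proof (intro conjI allI impI)
  fix R
  assume "R \<lhd> SL2_group \<and> closedin (zariski_topology 2) R \<and>
    connectedin (zariski_topology 2) R \<and> solvable (general_linear_group 2\<lparr>carrier := R\<rparr>)"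
  then have R: "R \<lhd> SL2_group" and conn: "connectedin (zariski_topology 2) R"
    and sol: "solvable (general_linear_group 2\<lparr>carrier := R\<rparr>)" by blast+
  have one: "1\<^sub>m 2 \<in> R"
    using subgroup.one_closed[OF normal_imp_subgroup[OF R]] by simp
  have "R \<noteq> SL2" using sol not_solvable_SL2 by auto
  then have central: "A = mat2 1 0 0 1 \<or> A = mat2 (- 1) 0 0 (- 1)" if A: "A \<in> R" for A
  proof -
    have "A \<in> SL2" using SL2_normal_subset[OF R] A by blast
    then obtain a b c d where A': "A = mat2 a b c d" "a * d - b * c = 1" by (rule SL2_E)
    then have "b = 0" "c = 0" "a = d" using SL2_noncentral_normal[OF R] \<open>R \<noteq> SL2\<close> A by blast+
    then have "a * a = 1" using A' by simp
    then show ?thesis using A' \<open>b = 0\<close> \<open>c = 0\<close> \<open>a = d\<close> by (auto simp: square_eq_1_iff)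
  qed
  have "mat2 (- 1) 0 0 (- 1) \<notin> R"
  proof
    assume minus: "mat2 (- 1) 0 0 (- 1) \<in> R"
    \<comment> \<open>These open sets separate the two central matrices, whose upper left entries are \<open>1\<close> and \<open>-1\<close>.\<close>
    define D where "D e = {A \<in> carrier (general_linear_group 2). A $$ (0, 0) + e \<noteq> 0}" for e :: real
    have "openin (zariski_topology 2) (D e)" for e
      unfolding D_def by (intro zariski_openin_basic polynomial_in_entries.intros) auto
    moreover have "R \<subseteq> carrier (general_linear_group 2)"
      using SL2_normal_subset[OF R] SL2_subset_GL2 by blast
    then have "R \<subseteq> D 1 \<union> D (- 1)" by (auto simp: D_def)
    moreover have "A $$ (0, 0) = 1 \<or> A $$ (0, 0) = - 1" if "A \<in> R" for A
      using central[OF that] by (elim disjE) (simp_all only: mat2_entries refl simp_thms)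
    then have "D 1 \<inter> D (- 1) \<inter> R = {}" by (fastforce simp: D_def)
    moreover have "1\<^sub>m 2 \<in> D 1" "mat2 (- 1) 0 0 (- 1) \<in> D (- 1)"
      using minus one \<open>R \<subseteq> carrier (general_linear_group 2)\<close> by (auto simp: D_def)
    then have "D 1 \<inter> R \<noteq> {}" "D (- 1) \<inter> R \<noteq> {}"
      using minus one by blast+
    ultimately show False using connectedinD[OF conn, of "D 1" "D (- 1)"] by blast
  qed
  then show "R = {\<one>\<^bsub>general_linear_group 2\<^esub>}"
    using central one by (auto simp: one_mat2)
qed (rule subgroup_SL2 zariski_closed_SL2 connectedin_zariski_SL2)+

subsection \<open>Zariski density of two opposite unipotents\<close>

lemma poly_zero_at_naturals:
  fixes q :: "real poly"
  assumes "\<And>n::nat. poly q (real n) = 0"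
  shows "q = 0"
proof (rule ccontr)
  assume "q \<noteq> 0"
  then have "finite {x. poly q x = 0}" by (rule poly_roots_finite)
  moreover have "range real \<subseteq> {x. poly q x = 0}" using assms by auto
  ultimately have "finite (range real)" by (rule rev_finite_subset)
  then show False using range_inj_infinite[of real] by simp
qed

text \<open>
  Real functions that are given by a polynomial, in a form that composes with
  \<open>polynomial_in_entries\<close>.
\<close>

definition poly_fun :: "(real \<Rightarrow> real) \<Rightarrow> bool" where
  "poly_fun f \<longleftrightarrow> (\<exists>q. \<forall>x. f x = poly q x)"

lemma poly_fun_intros:
  "poly_fun (\<lambda>_. c)" "poly_fun (\<lambda>x. x)"
  "poly_fun f \<Longrightarrow> poly_fun g \<Longrightarrow> poly_fun (\<lambda>x. f x + g x)"
  "poly_fun f \<Longrightarrow> poly_fun g \<Longrightarrow> poly_fun (\<lambda>x. f x * g x)"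
proof -
  show "poly_fun (\<lambda>_. c)" unfolding poly_fun_def by (rule exI[of _ "[:c:]"]) simp
  show "poly_fun (\<lambda>x. x)" unfolding poly_fun_def by (rule exI[of _ "[:0, 1:]"]) simp
  show "poly_fun f \<Longrightarrow> poly_fun g \<Longrightarrow> poly_fun (\<lambda>x. f x + g x)"
    unfolding poly_fun_def by (metis poly_add)
  show "poly_fun f \<Longrightarrow> poly_fun g \<Longrightarrow> poly_fun (\<lambda>x. f x * g x)"
    unfolding poly_fun_def by (metis poly_mult)
qed

lemma poly_fun_polynomial_in_entries:
  assumes "polynomial_in_entries N p" "\<And>i j. i < N \<Longrightarrow> j < N \<Longrightarrow> poly_fun (\<lambda>x. M x $$ (i, j))"
  shows "poly_fun (\<lambda>x. p (M x))"
  using assms by induction (auto intro: poly_fun_intros)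

text \<open>
  Restricted to a translate of a unipotent one-parameter group, a polynomial in the entries is a
  polynomial in the parameter; it vanishes as soon as it does so for infinitely many values.
\<close>

lemma polynomial_vanishing_on_line:
  assumes p: "polynomial_in_entries 2 p" and XY: "X \<in> carrier_mat 2 2" "Y \<in> carrier_mat 2 2"
    and M: "M = upper \<or> M = lower" and zero: "\<And>n::nat. p (X * (M (real n) * Y)) = 0"
  shows "p (X * (M x * Y)) = 0"
proof -
  obtain a b c d a' b' c' d' where "X = mat2 a b c d" "Y = mat2 a' b' c' d'"
    using XY mat2_exhaust by metis
  have "poly_fun (\<lambda>x. p (X * (M x * Y)))"
  proof (rule poly_fun_polynomial_in_entries[OF p])
    fix i j :: nat assume "i < 2" "j < 2"
    then have "i = 0 \<or> i = Suc 0" "j = 0 \<or> j = Suc 0" by auto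
    then show "poly_fun (\<lambda>x. (X * (M x * Y)) $$ (i, j))"
      using M by (auto simp: \<open>X = _\<close> \<open>Y = _\<close> intro!: poly_fun_intros)
  qed
  then obtain q where q: "\<And>x. p (X * (M x * Y)) = poly q x" by (auto simp: poly_fun_def)
  then have "q = 0" using zero by (intro poly_zero_at_naturals) metis
  then show ?thesis using q by simp
qed

text \<open>
  A polynomial that vanishes on \<open>D\<close> vanishes at the conjugates by \<open>t\<close> of all products
  \<open>upper a * lower b * upper c * lower d\<close> with natural parameters. The parameters are released to
  real values one at a time, after which the products exhaust the group.
\<close>

theorem zariski_dense_SL2:
  assumes D: "D \<subseteq> SL2" and one: "1\<^sub>m 2 \<in> D" and mult: "\<And>A B. A \<in> D \<Longrightarrow> B \<in> D \<Longrightarrow> A * B \<in> D"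
    and t: "t \<in> SL2" "t' \<in> SL2" "t * t' = 1\<^sub>m 2" "t' * t = 1\<^sub>m 2"
    and u: "t * upper 1 * t' \<in> D" and l: "t * lower 1 * t' \<in> D"
  shows "zariski_topology 2 closure_of D = SL2"
proof
  show "zariski_topology 2 closure_of D \<subseteq> SL2"
    by (rule closure_of_minimal[OF D zariski_closed_SL2])
  note tc = SL2_carrier[OF t(1)] SL2_carrier[OF t(2)]
  note assoc = assoc_mult_mat[of _ 2 2 _ 2 _ 2]
  note mc = mult_carrier_mat[of _ 2 2 _ 2]
  have conj: "t * (A * B) * t' = (t * A * t') * (t * B * t')"
    if "A \<in> carrier_mat 2 2" "B \<in> carrier_mat 2 2" for A B
  proof -
    have "(t * A * t') * (t * B * t') = t * (A * ((t' * t) * (B * t')))"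
      using that tc by (simp add: assoc mc del: mat2_mult)
    then show ?thesis
      unfolding t(4) using that tc by (simp add: assoc mc del: mat2_mult)
  qed
  have "t * 1\<^sub>m 2 * t' \<in> D" using t one tc by simp
  have unip: "t * upper (real n) * t' \<in> D" "t * lower (real n) * t' \<in> D" for n
  proof (induction n)
    case 0
    then show "t * upper (real 0) * t' \<in> D" "t * lower (real 0) * t' \<in> D"
      using \<open>t * 1\<^sub>m 2 * t' \<in> D\<close> by (simp_all add: one_mat2)
  next
    case (Suc n)
    have "upper (real (Suc n)) = upper (real n) * upper 1" "lower (real (Suc n)) = lower (real n) * lower 1"
      by simp_all
    then show "t * upper (real (Suc n)) * t' \<in> D" "t * lower (real (Suc n)) * t' \<in> D"
      using Suc u l mult conj[of "upper (real n)" "upper 1"] conj[of "lower (real n)" "lower 1"]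
      by (metis mat2_carrier)+
  qed
  show "SL2 \<subseteq> zariski_topology 2 closure_of D"
  proof
    fix A assume A: "A \<in> SL2"
    have "\<exists>y\<in>D. y \<in> T" if T: "A \<in> T" "openin (zariski_topology 2) T" for T
    proof (rule ccontr)
      assume none: "\<not> (\<exists>y\<in>D. y \<in> T)"
      obtain p where p: "polynomial_in_entries 2 p" "p A \<noteq> 0"
        "\<And>B. B \<in> carrier (general_linear_group 2) \<Longrightarrow> p B \<noteq> 0 \<Longrightarrow> B \<in> T"
        using zariski_basis[OF T(2,1)] by blast
      have pD: "p B = 0" if "B \<in> D" for B
        using p(3)[of B] none that D SL2_subset_GL2 by blast
      have 0: "p (t * (upper (real a) * (lower (real b) * (upper (real c) * (lower (real d) * t'))))) = 0" for a b c d
      proof -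
        have "t * (upper (real a) * (lower (real b) * (upper (real c) * lower (real d)))) * t' \<in> D"
          using unip[of a] unip[of b] unip[of c] unip[of d] mult by (simp add: conj mc del: mat2_mult)
        then show ?thesis using pD tc by (simp add: assoc mc del: mat2_mult)
      qed
      note van = polynomial_vanishing_on_line[OF p(1)]
      have 1: "p (t * (upper x * (lower (real b) * (upper (real c) * (lower (real d) * t'))))) = 0" for x b c d
        by (rule van[where M = upper]; use tc 0 in \<open>simp add: mc del: mat2_mult\<close>)
      have 2: "p (t * (upper x * (lower y * (upper (real c) * (lower (real d) * t'))))) = 0" for x y c d
      proof -
        have "p ((t * upper x) * (lower y * (upper (real c) * (lower (real d) * t')))) = 0"
          by (rule van[where M = lower]; use tc 1 in \<open>simp add: mc assoc del: mat2_mult\<close>)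
        then show ?thesis using tc by (simp add: mc assoc del: mat2_mult)
      qed
      have 3: "p (t * (upper x * (lower y * (upper z * (lower (real d) * t'))))) = 0" for x y z d
      proof -
        have "p ((t * upper x * lower y) * (upper z * (lower (real d) * t'))) = 0"
          by (rule van[where M = upper]; use tc 2 in \<open>simp add: mc assoc del: mat2_mult\<close>)
        then show ?thesis using tc by (simp add: mc assoc del: mat2_mult)
      qed
      have 4: "p (t * (upper x * (lower y * (upper z * (lower w * t'))))) = 0" for x y z w
      proof -
        have "p ((t * upper x * lower y * upper z) * (lower w * t')) = 0"
          by (rule van[where M = lower]; use tc 3 in \<open>simp add: mc assoc del: mat2_mult\<close>)
        then show ?thesis using tc by (simp add: mc assoc del: mat2_mult)
      qed
      have "t' * A * t \<in> SL2" using A t SL2_mult_closed by blast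
      then obtain x y z w where e: "t' * A * t = upper x * (lower y * (upper z * lower w))"
        by (rule SL2_elementary)
      have "A = t * (t' * A * t) * t'"
      proof -
        have "t * (t' * A * t) * t' = (t * t') * (A * (t * t'))"
          using tc SL2_carrier[OF A] by (simp add: mc assoc del: mat2_mult)
        then show ?thesis using t SL2_carrier[OF A] by simp
      qed
      also have "\<dots> = t * (upper x * (lower y * (upper z * (lower w * t'))))"
        unfolding e using tc by (simp add: mc assoc del: mat2_mult)
      finally show False using 4 p(2) by metis
    qed
    then show "A \<in> zariski_topology 2 closure_of D"
      using A SL2_subset_GL2 by (auto simp: in_closure_of topspace_zariski)
  qed
qed

section \<open>Hyperplanes and their normal vectors\<close>

no_notation Matrix.vec_index (infixl "$" 100)

definition pairing :: "complex ^ 'n::finite \<Rightarrow> complex ^ 'n \<Rightarrow> complex" where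
  "pairing a x = (\<Sum>i\<in>UNIV. a $ i * x $ i)"

lemma pairing_scale [simp]: "pairing (c *s a) x = c * pairing a x" "pairing a (c *s x) = c * pairing a x"
  by (simp_all add: pairing_def sum_distrib_left mult_ac)

lemma pairing_add: "pairing (a + b) x = pairing a x + pairing b x" "pairing a (x + y) = pairing a x + pairing a y"
  by (simp_all add: pairing_def sum.distrib ring_distribs)

lemma pairing_diff: "pairing (a - b) x = pairing a x - pairing b x" "pairing a (x - y) = pairing a x - pairing a y"
  by (simp_all add: pairing_def sum_subtractf ring_distribs)

lemma pairing_zero [simp]: "pairing 0 x = 0" "pairing a 0 = 0"
  by (simp_all add: pairing_def)

lemma pairing_adjoint: "pairing (a v* B) x = pairing a (B *v x)"
proof -
  have "pairing (a v* B) x = (\<Sum>i\<in>UNIV. \<Sum>j\<in>UNIV. a $ j * B $ j $ i * x $ i)"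
    by (simp add: pairing_def vector_matrix_mult_def sum_distrib_right)
  also have "\<dots> = (\<Sum>j\<in>UNIV. \<Sum>i\<in>UNIV. a $ j * B $ j $ i * x $ i)"
    by (rule sum.swap)
  also have "\<dots> = pairing a (B *v x)"
    by (simp add: pairing_def matrix_vector_mult_def sum_distrib_left mult_ac)
  finally show ?thesis .
qed

lemma line_in_hyperplane_iff:
  assumes "v \<noteq> 0"
  shows "vec.span {v} \<in> hyperplane a \<longleftrightarrow> pairing a v = 0"
proof -
  have "vec.span {v} \<in> projective_space" using assms by (auto simp: projective_space_def)
  moreover have "(\<forall>x\<in>vec.span {v}. pairing a x = 0) \<longleftrightarrow> pairing a v = 0"
    by (auto simp: vec.span_singleton dest!: spec[of _ 1])
  ultimately show ?thesis by (simp add: hyperplane_def pairing_def)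
qed

lemma hyperplane_eq: "hyperplane a = {vec.span {v} | v. v \<noteq> 0 \<and> pairing a v = 0}"
proof -
  have "p \<in> projective_space" if "p \<in> hyperplane a" for p using that by (simp add: hyperplane_def)
  then show ?thesis
    using line_in_hyperplane_iff[of _ a] by (fastforce simp: projective_space_def)
qed

lemma hyperplane_scale:
  assumes "c \<noteq> 0"
  shows "hyperplane (c *s a) = hyperplane a"
  using assms by (simp add: hyperplane_eq)

lemma hyperplane_eq_imp_proportional:
  assumes "hyperplane a = hyperplane b" "a \<noteq> 0" "b \<noteq> 0"
  obtains c where "c \<noteq> 0" "b = c *s a"
proof -
  obtain i where i: "a $ i \<noteq> 0" using assms(2) by (auto simp: Finite_Cartesian_Product.vec_eq_iff)
  have "b $ j = (b $ i / a $ i) * a $ j" for j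
  proof -
    define v :: "complex ^ 'a" where "v = a $ i *s axis j 1 - a $ j *s axis i 1"
    have v: "pairing d v = d $ j * a $ i - d $ i * a $ j" for d
      by (simp add: v_def pairing_diff) (simp add: pairing_def axis_def if_distrib[of "(*) _"] cong: if_cong)
    have "pairing b v = 0"
    proof (cases "v = 0")
      case False
      then show ?thesis
        using line_in_hyperplane_iff[OF False] v[of a] assms(1) by (metis diff_self mult.commute)
    qed simp
    then show ?thesis using v[of b] i by (simp add: field_simps)
  qed
  then have b: "b = (b $ i / a $ i) *s a"
    unfolding Finite_Cartesian_Product.vec_eq_iff vector_smult_component by blast
  have "b $ i / a $ i \<noteq> 0"
  proof
    assume "b $ i / a $ i = 0"
    then have "b = 0 *s a" by (subst b) simp
    then show False using assms(3) by simp
  qed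
  then show thesis using b by (rule that)
qed

lemma image_line: "(*v) A ` vec.span {v} = vec.span {A *v v}"
  by (auto simp: vec.span_singleton vector_scalar_commute image_image)

text \<open>
  On normal vectors a projective transformation acts by the transposed inverse matrix.
\<close>

lemma image_hyperplane:
  fixes A :: "complex ^ 'n::finite ^ 'n"
  assumes "A ** B = Finite_Cartesian_Product.mat 1" "B ** A = Finite_Cartesian_Product.mat 1"
  shows "(\<lambda>p. (*v) A ` p) ` hyperplane a = hyperplane (a v* B)"
proof -
  have AB: "A *v (B *v x) = x" and BA: "B *v (A *v x) = x" for x
    using assms by (simp_all add: matrix_vector_mul_assoc)
  have nz: "A *v v \<noteq> 0 \<longleftrightarrow> v \<noteq> 0" "B *v v \<noteq> 0 \<longleftrightarrow> v \<noteq> 0" for v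
    using AB BA by (metis matrix_vector_mult_0_right)+
  show ?thesis
  proof
    show "(\<lambda>p. (*v) A ` p) ` hyperplane a \<subseteq> hyperplane (a v* B)"
      by (auto simp: hyperplane_eq image_line pairing_adjoint) (metis BA nz(1))
    show "hyperplane (a v* B) \<subseteq> (\<lambda>p. (*v) A ` p) ` hyperplane a"
    proof
      fix p assume "p \<in> hyperplane (a v* B)"
      then obtain v where "p = vec.span {v}" "v \<noteq> 0" "pairing a (B *v v) = 0"
        by (auto simp: hyperplane_eq pairing_adjoint)
      then have "p = (*v) A ` vec.span {B *v v}" "vec.span {B *v v} \<in> hyperplane a"
        using nz(2) by (auto simp: image_line AB line_in_hyperplane_iff)
      then show "p \<in> (\<lambda>p. (*v) A ` p) ` hyperplane a" by blast
    qed
  qed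
qed

lemma topspace_dual_projective_space: "topspace dual_projective_space = hyperplane ` (- {0})"
  by (simp add: dual_projective_space_def topspace_quotient_topology)

lemma continuous_map_hyperplane: "continuous_map (top_of_set (- {0})) dual_projective_space hyperplane"
  unfolding dual_projective_space_def
  by (rule quotient_imp_continuous_map[OF quotient_map_quotient_topology])

definition normal_vector :: "(complex ^ 'n::finite) set set \<Rightarrow> complex ^ 'n" where
  "normal_vector h = (SOME a. a \<noteq> 0 \<and> hyperplane a = h)"

lemma normal_vector:
  assumes "h \<in> topspace dual_projective_space"
  shows "normal_vector h \<noteq> 0" "hyperplane (normal_vector h) = h"
proof -
  obtain a where "a \<noteq> 0 \<and> hyperplane a = h"
    using assms by (auto simp: topspace_dual_projective_space)
  then have "normal_vector h \<noteq> 0 \<and> hyperplane (normal_vector h) = h"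
    unfolding normal_vector_def by (rule someI)
  then show "normal_vector h \<noteq> 0" "hyperplane (normal_vector h) = h" by auto
qed

text \<open>
  The orthogonal projection of \<open>w\<close> to the line through \<open>a\<close> depends on the line only. For lines
  close to that of \<open>w\<close> it is a nonzero vector in the line, so it is a continuous choice of
  normal vectors near the hyperplane with normal vector \<open>w\<close>.
\<close>

definition project_onto_line :: "complex ^ 'n::finite \<Rightarrow> complex ^ 'n \<Rightarrow> complex ^ 'n" where
  "project_onto_line w a = ((\<Sum>i\<in>UNIV. cnj (a $ i) * w $ i) / (\<Sum>i\<in>UNIV. cnj (a $ i) * a $ i)) *s a"

lemma hermitian_square_nonzero:
  fixes a :: "complex ^ 'n::finite"
  assumes "a \<noteq> 0"
  shows "(\<Sum>i\<in>UNIV. cnj (a $ i) * a $ i) \<noteq> 0"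
proof
  assume *: "(\<Sum>i\<in>UNIV. cnj (a $ i) * a $ i) = 0"
  have "cnj z * z = of_real ((cmod z)\<^sup>2)" for z
    using complex_norm_square[of z] by (simp add: mult.commute)
  then have "complex_of_real (\<Sum>i\<in>UNIV. (cmod (a $ i))\<^sup>2) = 0" using * by simp
  then have "(\<Sum>i\<in>UNIV. (cmod (a $ i))\<^sup>2) = 0" by (simp only: of_real_eq_0_iff)
  then have "\<forall>i. a $ i = 0" by (simp add: sum_nonneg_eq_0_iff)
  then show False using assms by (simp add: Finite_Cartesian_Product.vec_eq_iff)
qed

lemma project_onto_line_scale:
  assumes "c \<noteq> 0"
  shows "project_onto_line w (c *s a) = project_onto_line w a"
proof -
  have "(\<Sum>i\<in>UNIV. cnj ((c *s a) $ i) * w $ i) = cnj c * (\<Sum>i\<in>UNIV. cnj (a $ i) * w $ i)"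
    "(\<Sum>i\<in>UNIV. cnj ((c *s a) $ i) * (c *s a) $ i) = cnj c * c * (\<Sum>i\<in>UNIV. cnj (a $ i) * a $ i)"
    by (simp_all add: sum_distrib_left mult_ac)
  then show ?thesis
    using assms unfolding project_onto_line_def by (simp add: Finite_Cartesian_Product.vec_eq_iff)
qed

lemma project_onto_own_line: "a \<noteq> 0 \<Longrightarrow> project_onto_line a a = a"
  by (simp add: project_onto_line_def hermitian_square_nonzero)

lemma continuous_map_project_onto_line:
  "continuous_map dual_projective_space euclidean (\<lambda>h. project_onto_line w (normal_vector h))"
proof -
  have "continuous_on (- {0}) (project_onto_line w)"
    unfolding project_onto_line_def vector_scalar_mult_def
    by (intro continuous_intros) (auto simp: hermitian_square_nonzero)
  moreover have "project_onto_line w (normal_vector (hyperplane a)) = project_onto_line w a" if "a \<noteq> 0" for a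
  proof -
    have "hyperplane a \<in> topspace dual_projective_space"
      using that by (auto simp: topspace_dual_projective_space)
    note n = normal_vector[OF this]
    have "\<exists>c. c \<noteq> 0 \<and> normal_vector (hyperplane a) = c *s a"
      using hyperplane_eq_imp_proportional[OF n(2)[symmetric] \<open>a \<noteq> 0\<close> n(1)] by blast
    then show ?thesis by (auto simp: project_onto_line_scale)
  qed
  ultimately have "continuous_on (- {0}) (\<lambda>a. project_onto_line w (normal_vector (hyperplane a)))"
    by (subst continuous_on_cong[OF refl]) auto
  then have "continuous_map (top_of_set (- {0})) euclidean
      ((\<lambda>h. project_onto_line w (normal_vector h)) \<circ> hyperplane)"
    by (simp add: o_def)
  then show ?thesis
    using continuous_compose_quotient_map_eq[OF quotient_map_quotient_topology]
    unfolding dual_projective_space_def by blast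
qed

lemma general_position_hyperplanes:
  fixes a :: "nat \<Rightarrow> complex ^ 'n::finite"
  shows "general_position m (\<lambda>i. hyperplane (a i)) \<longleftrightarrow>
    (\<forall>I \<subseteq> {..<m}. card I = CARD('n) \<longrightarrow> (\<forall>x. (\<forall>i\<in>I. pairing (a i) x = 0) \<longrightarrow> x = 0))"
proof -
  have "(\<Inter>i\<in>I. hyperplane (a i)) = {} \<longleftrightarrow> (\<forall>x. (\<forall>i\<in>I. pairing (a i) x = 0) \<longrightarrow> x = 0)"
    if "card I = CARD('n)" for I
  proof -
    have "I \<noteq> {}" using that by auto
    have "p \<in> (\<Inter>i\<in>I. hyperplane (a i)) \<longleftrightarrow> (\<exists>x. x \<noteq> 0 \<and> p = vec.span {x} \<and> (\<forall>i\<in>I. pairing (a i) x = 0))" for p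
    proof
      assume p: "p \<in> (\<Inter>i\<in>I. hyperplane (a i))"
      then obtain x where "x \<noteq> 0" "p = vec.span {x}" using \<open>I \<noteq> {}\<close> by (auto simp: hyperplane_eq)
      then show "\<exists>x. x \<noteq> 0 \<and> p = vec.span {x} \<and> (\<forall>i\<in>I. pairing (a i) x = 0)"
        using p line_in_hyperplane_iff by blast
    qed (auto simp: line_in_hyperplane_iff)
    then have "(\<exists>p. p \<in> (\<Inter>i\<in>I. hyperplane (a i))) \<longleftrightarrow> (\<exists>x. x \<noteq> 0 \<and> (\<forall>i\<in>I. pairing (a i) x = 0))"
      by (simp only:) blast
    then show ?thesis unfolding ex_in_conv by metis
  qed
  then show ?thesis unfolding general_position_def by (simp only: cong: imp_cong)
qed

lemma general_position_cong:
  assumes "\<And>i. i < m \<Longrightarrow> H i = H' i"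
  shows "general_position m H = general_position m H'"
proof -
  have "(\<Inter>i\<in>I. H i) = (\<Inter>i\<in>I. H' i)" if "I \<subseteq> {..<m}" for I
    using assms that by (intro INF_cong) auto
  then show ?thesis unfolding general_position_def by auto
qed

section \<open>The cross ratio of a configuration\<close>

text \<open>
  Hyperplanes are numbered by natural numbers, the rows of a square matrix by the type \<open>'n\<close>.
\<close>

definition coordinate_index :: "'n::finite \<Rightarrow> nat" where
  "coordinate_index = (SOME e. bij_betw e UNIV {..<CARD('n)})"

lemma bij_coordinate_index: "bij_betw (coordinate_index :: 'n::finite \<Rightarrow> nat) UNIV {..<CARD('n)}"
proof -
  have "\<exists>e. bij_betw e (UNIV :: 'n set) {..<CARD('n)}"
    using ex_bij_betw_finite_nat[of "UNIV :: 'n set"] by (simp add: atLeast0LessThan)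
  then show ?thesis unfolding coordinate_index_def by (rule someI_ex)
qed

lemma coordinate_index_less: "coordinate_index (k :: 'n::finite) < CARD('n)"
  using bij_coordinate_index[where 'n = 'n] by (auto simp: bij_betw_def)

lemma coordinate_index_inj: "coordinate_index k = coordinate_index l \<longleftrightarrow> k = l"
  using bij_coordinate_index by (auto simp: bij_betw_def inj_on_def)

text \<open>
  The rows of a bracket are the normal vectors number \<open>i, j, 2, \<dots>, CARD('n) - 1\<close>, so that two
  brackets differ in the first two rows only.
\<close>

definition row_index :: "nat \<Rightarrow> nat \<Rightarrow> 'n::finite \<Rightarrow> nat" where
  "row_index i j k = (if coordinate_index k = 0 then i else if coordinate_index k = 1 then j else coordinate_index k)"

definition bracket :: "(nat \<Rightarrow> complex ^ 'n::finite) \<Rightarrow> nat \<Rightarrow> nat \<Rightarrow> complex" where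
  "bracket a i j = det (\<chi> k. a (row_index i j k))"

lemma bracket_eq_0_iff:
  fixes a :: "nat \<Rightarrow> complex ^ 'n::finite"
  shows "bracket a i j = 0 \<longleftrightarrow> (\<exists>x. x \<noteq> 0 \<and> (\<forall>k::'n. pairing (a (row_index i j k)) x = 0))"
proof -
  let ?A = "(\<chi> k. a (row_index i j k)) :: complex ^ 'n ^ 'n"
  have "bracket a i j \<noteq> 0 \<longleftrightarrow> (\<forall>x. ?A *v x = 0 \<longrightarrow> x = 0)"
    unfolding bracket_def by (metis invertible_det_nz invertible_left_inverse matrix_left_invertible_ker)
  moreover have "?A *v x = 0 \<longleftrightarrow> (\<forall>k::'n. pairing (a (row_index i j k)) x = 0)" for x
    by (simp add: Finite_Cartesian_Product.vec_eq_iff matrix_vector_mult_def pairing_def)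
  ultimately show ?thesis by blast
qed

lemma bracket_nonzero:
  fixes a :: "nat \<Rightarrow> complex ^ 'n::finite"
  assumes gp: "general_position m (\<lambda>i. hyperplane (a i))" and m: "CARD('n) \<le> m"
    and ij: "i < m" "j < m" "i \<noteq> j" "i \<notin> {2..<CARD('n)}" "j \<notin> {2..<CARD('n)}"
  shows "bracket a i j \<noteq> 0"
proof -
  let ?I = "range (row_index i j :: 'n \<Rightarrow> nat)"
  have "inj (row_index i j :: 'n \<Rightarrow> nat)"
  proof (rule injI)
    fix k l :: 'n
    assume "row_index i j k = row_index i j l"
    then have "coordinate_index k = coordinate_index l"
      using ij coordinate_index_less[of k] coordinate_index_less[of l]
      by (auto simp: row_index_def split: if_splits)
    then show "k = l" by (simp add: coordinate_index_inj)
  qed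
  then have "card ?I = CARD('n)" by (simp add: card_image)
  moreover have "row_index i j k < m" for k :: 'n
    using ij m coordinate_index_less[of k] by (auto simp: row_index_def)
  then have "?I \<subseteq> {..<m}" by auto
  ultimately have "\<forall>x. (\<forall>i\<in>?I. pairing (a i) x = 0) \<longrightarrow> x = 0"
    using gp unfolding general_position_hyperplanes by blast
  then show ?thesis unfolding bracket_eq_0_iff by auto
qed

text \<open>
  Up to a common factor, a bracket is the determinant of two linear forms restricted to the line in which the
  hyperplanes number \<open>2, \<dots>, CARD('n) - 1\<close> meet. This is therefore the classical cross ratio of
  the four points in which this line meets the hyperplanes number \<open>0\<close>, \<open>1\<close>, \<open>CARD('n)\<close> and
  \<open>CARD('n) + 1\<close>.
\<close>

definition cross_ratio_vectors :: "(nat \<Rightarrow> complex ^ 'n::finite) \<Rightarrow> complex" where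
  "cross_ratio_vectors a =
     bracket a 0 CARD('n) * bracket a 1 (CARD('n) + 1) / (bracket a 0 (CARD('n) + 1) * bracket a 1 CARD('n))"

lemma tendsto_cross_ratio_vectors:
  fixes a :: "'x \<Rightarrow> nat \<Rightarrow> complex ^ 'n::finite"
  assumes lim: "\<And>i. i < CARD('n) + 2 \<Longrightarrow> ((\<lambda>x. a x i) \<longlongrightarrow> b i) F"
    and nz: "bracket b 0 (CARD('n) + 1) \<noteq> 0" "bracket b 1 CARD('n) \<noteq> 0"
  shows "((\<lambda>x. cross_ratio_vectors (a x)) \<longlongrightarrow> cross_ratio_vectors b) F"
proof -
  have "((\<lambda>x. bracket (a x) i j) \<longlongrightarrow> bracket b i j) F" if "i < CARD('n) + 2" "j < CARD('n) + 2" for i j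
  proof -
    have "row_index i j k < CARD('n) + 2" for k :: 'n
      using that coordinate_index_less[of k] by (auto simp: row_index_def)
    then show ?thesis
      unfolding bracket_def det_def by (auto intro!: tendsto_intros lim)
  qed
  then show ?thesis
    unfolding cross_ratio_vectors_def using nz by (intro tendsto_intros) auto
qed

text \<open>
  Each of the four indices \<open>0\<close>, \<open>1\<close>, \<open>CARD('n)\<close> and \<open>CARD('n) + 1\<close> occurs once in the numerator
  and once in the denominator, so the factors cancel.
\<close>

lemma cross_ratio_vectors_eqI:
  fixes a b :: "nat \<Rightarrow> complex ^ 'n::finite"
  assumes "\<And>i j. i < CARD('n) + 2 \<Longrightarrow> j < CARD('n) + 2 \<Longrightarrow> bracket b i j = d * f i * f j * bracket a i j"
    and "d \<noteq> 0" "\<And>i. i < CARD('n) + 2 \<Longrightarrow> f i \<noteq> 0"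
  shows "cross_ratio_vectors b = cross_ratio_vectors a"
  using assms(2,3) unfolding cross_ratio_vectors_def by (simp add: assms(1))

lemma cross_ratio_vectors_scale:
  fixes a b :: "nat \<Rightarrow> complex ^ 'n::finite"
  assumes n: "CARD('n) \<ge> 2" and b: "\<And>i. i < CARD('n) + 2 \<Longrightarrow> b i = c i *s a i"
    and c: "\<And>i. i < CARD('n) + 2 \<Longrightarrow> c i \<noteq> 0"
  shows "cross_ratio_vectors b = cross_ratio_vectors a"
proof (rule cross_ratio_vectors_eqI[where f = c and d = "\<Prod>k\<in>{2..<CARD('n)}. c k"])
  fix i j assume ij: "i < CARD('n) + 2" "j < CARD('n) + 2"
  have less: "row_index i j k < CARD('n) + 2" for k :: 'n
    using ij coordinate_index_less[of k] by (auto simp: row_index_def)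
  have "bracket b i j = det (\<chi> k::'n. c (row_index i j k) *s a (row_index i j k))"
    unfolding bracket_def using b less by simp
  also have "\<dots> = (\<Prod>k\<in>UNIV. c (row_index i j (k::'n))) * bracket a i j"
    unfolding bracket_def by (rule det_rows_mul)
  also have "(\<Prod>k\<in>UNIV. c (row_index i j (k::'n))) =
      (\<Prod>k<CARD('n). c (if k = 0 then i else if k = 1 then j else k))"
    unfolding row_index_def by (rule prod.reindex_bij_betw[OF bij_coordinate_index])
  also have "{..<CARD('n)} = insert 0 (insert 1 {2..<CARD('n)})" using n by auto
  also have "(\<Prod>k\<in>insert 0 (insert 1 {2..<CARD('n)}). c (if k = 0 then i else if k = 1 then j else k)) =
      c i * (c j * (\<Prod>k\<in>{2..<CARD('n)}. c (if k = 0 then i else if k = 1 then j else k)))"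
    by simp
  also have "(\<Prod>k\<in>{2..<CARD('n)}. c (if k = 0 then i else if k = 1 then j else k)) = (\<Prod>k\<in>{2..<CARD('n)}. c k)"
    by (rule prod.cong) auto
  finally show "bracket b i j = (\<Prod>k\<in>{2..<CARD('n)}. c k) * c i * c j * bracket a i j"
    by (simp add: mult_ac)
qed (use c in auto)

lemma cross_ratio_vectors_linear:
  fixes a :: "nat \<Rightarrow> complex ^ 'n::finite"
  assumes "det B \<noteq> 0"
  shows "cross_ratio_vectors (\<lambda>i. a i v* B) = cross_ratio_vectors a"
proof (rule cross_ratio_vectors_eqI[where f = "\<lambda>_. 1" and d = "det B"])
  fix i j
  have "(\<chi> k::'n. a (row_index i j k) v* B) = (\<chi> k. a (row_index i j k)) ** B"
    by (simp add: Finite_Cartesian_Product.vec_eq_iff vector_matrix_mult_def matrix_matrix_mult_def mult.commute)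
  then show "bracket (\<lambda>i. a i v* B) i j = det B * 1 * 1 * bracket a i j"
    by (simp add: bracket_def det_mul)
qed (use assms in auto)

lemma bracket_update_linear:
  fixes a :: "nat \<Rightarrow> complex ^ 'n::finite"
  assumes "j \<noteq> 0"
  shows "bracket (a(0 := c *s v + d *s w)) 0 j = c * bracket (a(0 := v)) 0 j + d * bracket (a(0 := w)) 0 j"
proof -
  have "0 \<in> coordinate_index ` (UNIV :: 'n set)"
    using bij_coordinate_index[where 'n = 'n] by (auto simp: bij_betw_def)
  then obtain k0 :: 'n where "coordinate_index k0 = 0" by force
  then have k0: "coordinate_index k = 0 \<longleftrightarrow> k = k0" for k :: 'n
    using coordinate_index_inj[of k k0] by simp
  have upd: "bracket (a(0 := v)) 0 j = det (\<chi> k. if k = k0 then v else a (row_index 0 j k))" for v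
    unfolding bracket_def
    by (rule arg_cong[of _ _ det]) (use assms in \<open>auto simp: Finite_Cartesian_Product.vec_eq_iff row_index_def k0\<close>)
  show ?thesis unfolding upd by (simp add: det_row_add det_row_mul)
qed

lemma bracket_update_other:
  assumes "j \<noteq> 0"
  shows "bracket (a(0 := a 1)) 0 j = bracket a 1 j"
  unfolding bracket_def
  by (rule arg_cong[of _ _ det]) (use assms in \<open>auto simp: Finite_Cartesian_Product.vec_eq_iff row_index_def\<close>)

text \<open>
  If the cross ratio is \<open>1\<close>, some combination \<open>w\<close> of the normal vectors number \<open>0\<close> and \<open>1\<close>, with
  coefficient \<open>1\<close> at number \<open>0\<close>, has vanishing brackets with both numbers \<open>CARD('n)\<close> and
  \<open>CARD('n) + 1\<close>. This yields two points \<open>y\<close> and \<open>y'\<close> of the line common to the hyperplanes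
  number \<open>2, \<dots>, CARD('n) - 1\<close> at which \<open>w\<close> vanishes. By general position they are
  different, so \<open>w\<close> vanishes on the whole line, and in particular at its intersection with
  hyperplane number \<open>1\<close>. There the normal vector number \<open>0\<close> vanishes as well, which contradicts
  general position.
\<close>

lemma cross_ratio_vectors_neq_01:
  fixes a :: "nat \<Rightarrow> complex ^ 'n::finite"
  assumes n: "CARD('n) \<ge> 2" and m: "m \<ge> CARD('n) + 2"
    and gp: "general_position m (\<lambda>i. hyperplane (a i))"
  shows "cross_ratio_vectors a \<noteq> 0" "cross_ratio_vectors a \<noteq> 1"
proof -
  let ?r = "CARD('n)" and ?s = "CARD('n) + 1"
  have nz: "bracket a i j \<noteq> 0" if "i \<in> {0, 1, ?r, ?s}" "j \<in> {0, 1, ?r, ?s}" "i \<noteq> j" for i j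
    using that n m by (intro bracket_nonzero[OF gp]) auto
  then show "cross_ratio_vectors a \<noteq> 0" using n by (auto simp: cross_ratio_vectors_def)
  have trivial: "x = 0"
    if "\<And>k::'n. coordinate_index k \<ge> 2 \<Longrightarrow> pairing (a (coordinate_index k)) x = 0"
      "pairing (a i) x = 0" "pairing (a j) x = 0" "i \<in> {0, 1, ?r, ?s}" "j \<in> {0, 1, ?r, ?s}" "i \<noteq> j" for x i j
    using nz[OF that(4-6)] that(1-3) unfolding bracket_eq_0_iff row_index_def
    by (auto simp: not_le less_2_cases_iff split: if_splits)
  show "cross_ratio_vectors a \<noteq> 1"
  proof
    assume eq: "cross_ratio_vectors a = 1"
    define c where "c = bracket a 0 ?r / bracket a 1 ?r"
    define w where "w = 1 *s a 0 + (- c) *s a 1"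
    have "bracket a 0 ?s = c * bracket a 1 ?s" "bracket a 0 ?r = c * bracket a 1 ?r"
      using eq nz[of 0 ?s] nz[of 1 ?r] n by (auto simp: cross_ratio_vectors_def c_def field_simps)
    moreover have "bracket (a(0 := w)) 0 j = bracket a 0 j - c * bracket a 1 j" if "j \<noteq> 0" for j
      unfolding w_def bracket_update_linear[OF that] by (simp only: bracket_update_other[OF that] fun_upd_triv) simp
    ultimately have "bracket (a(0 := w)) 0 j = 0" if "j \<in> {?r, ?s}" for j
      using that by auto
    have "\<exists>y. y \<noteq> 0 \<and> pairing w y = 0 \<and> pairing (a j) y = 0 \<and>
        (\<forall>k::'n. coordinate_index k \<ge> 2 \<longrightarrow> pairing (a (coordinate_index k)) y = 0)" if j: "j \<in> {?r, ?s}" for j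
    proof -
      have "0 \<in> coordinate_index ` (UNIV :: 'n set)" "1 \<in> coordinate_index ` (UNIV :: 'n set)"
        using bij_coordinate_index[where 'n = 'n] n by (auto simp: bij_betw_def)
      then obtain k0 k1 :: 'n where k: "coordinate_index k0 = 0" "coordinate_index k1 = 1" by (metis imageE)
      obtain y where y: "y \<noteq> 0" "\<And>k::'n. pairing ((a(0 := w)) (row_index 0 j k)) y = 0"
        using \<open>j \<in> {?r, ?s} \<Longrightarrow> bracket (a(0 := w)) 0 j = 0\<close>[OF j] unfolding bracket_eq_0_iff by blast
      have "pairing (a (coordinate_index k)) y = 0" if "coordinate_index k \<ge> 2" for k :: 'n
        using y(2)[of k] that by (simp add: row_index_def)
      then show ?thesis
        using y(1) y(2)[of k0] y(2)[of k1] k j by (auto simp: row_index_def)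
    qed
    then obtain y y' where y: "y \<noteq> 0" "pairing w y = 0" "pairing (a ?r) y = 0"
        "\<And>k::'n. coordinate_index k \<ge> 2 \<Longrightarrow> pairing (a (coordinate_index k)) y = 0"
      and y': "y' \<noteq> 0" "pairing w y' = 0" "pairing (a ?s) y' = 0"
        "\<And>k::'n. coordinate_index k \<ge> 2 \<Longrightarrow> pairing (a (coordinate_index k)) y' = 0"
      by (metis insertI1 insertI2)
    \<comment> \<open>The intersection of hyperplane number \<open>1\<close> with the line through \<open>y\<close> and \<open>y'\<close>.\<close>
    define z where "z = pairing (a 1) y' *s y - pairing (a 1) y *s y'"
    have a0: "pairing (a 0) x = pairing w x + c * pairing (a 1) x" for x
      by (simp add: w_def pairing_diff)
    have "z = 0"
    proof (rule trivial[where i = 0 and j = 1])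
      show "pairing (a 1) z = 0" by (simp add: z_def pairing_diff)
      then show "pairing (a 0) z = 0" unfolding a0 using y y' by (simp add: z_def pairing_diff)
    qed (use y y' in \<open>auto simp: z_def pairing_diff\<close>)
    moreover have "pairing (a ?s) z = pairing (a 1) y' * pairing (a ?s) y"
      using y' by (simp add: z_def pairing_diff)
    ultimately consider "pairing (a 1) y' = 0" | "pairing (a ?s) y = 0" by auto
    then show False
    proof cases
      case 1
      then have "y' = 0"
        using y' n by (intro trivial[where i = 0 and j = 1]) (auto simp: a0)
      then show False using y' by simp
    next
      case 2
      then have "y = 0"
        using y n by (intro trivial[where i = ?r and j = ?s]) auto
      then show False using y by simp
    qed
  qed
qed

definition cross_ratio :: "(nat \<Rightarrow> (complex ^ 'n::finite) set set) \<Rightarrow> complex" where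
  "cross_ratio H = cross_ratio_vectors (\<lambda>i. normal_vector (H i))"

lemma cross_ratio_hyperplanes:
  fixes a :: "nat \<Rightarrow> complex ^ 'n::finite"
  assumes n: "CARD('n) \<ge> 2" and a: "\<And>i. i < CARD('n) + 2 \<Longrightarrow> a i \<noteq> 0 \<and> H i = hyperplane (a i)"
  shows "cross_ratio H = cross_ratio_vectors a"
proof -
  have "\<exists>c. c \<noteq> 0 \<and> normal_vector (H i) = c *s a i" if "i < CARD('n) + 2" for i
  proof -
    have "H i \<in> topspace dual_projective_space"
      using a[OF that] by (auto simp: topspace_dual_projective_space)
    note n = normal_vector[OF this]
    show ?thesis
      using hyperplane_eq_imp_proportional[of "a i" "normal_vector (H i)"] n a[OF that] by metis
  qed
  then obtain c where "\<And>i. i < CARD('n) + 2 \<Longrightarrow> c i \<noteq> 0 \<and> normal_vector (H i) = c i *s a i" by metis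
  then show ?thesis
    unfolding cross_ratio_def by (intro cross_ratio_vectors_scale[OF n, where c = c]) auto
qed

lemma topspace_hyperplane_configurations:
  "topspace (hyperplane_configurations m) =
     {H \<in> extensional {..<m}. (\<forall>i<m. H i \<in> topspace dual_projective_space) \<and> general_position m H}"
  unfolding hyperplane_configurations_def topspace_subtopology topspace_product_topology
  by (rule Set.set_eqI) (simp add: PiE_iff Ball_def conj_ac)

lemma configuration_normal_vectors:
  assumes "H \<in> topspace (hyperplane_configurations m)"
  shows "i < m \<Longrightarrow> normal_vector (H i) \<noteq> 0" "i < m \<Longrightarrow> H i = hyperplane (normal_vector (H i))"
    and "general_position m (\<lambda>i. hyperplane (normal_vector (H i)))"
proof -
  have H: "\<forall>i<m. H i \<in> topspace dual_projective_space" "general_position m H"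
    using assms by (auto simp: topspace_hyperplane_configurations)
  then show "i < m \<Longrightarrow> normal_vector (H i) \<noteq> 0" "i < m \<Longrightarrow> H i = hyperplane (normal_vector (H i))"
    using normal_vector by auto
  show "general_position m (\<lambda>i. hyperplane (normal_vector (H i)))"
    using H normal_vector general_position_cong[of m H "\<lambda>i. hyperplane (normal_vector (H i))"] by auto
qed

text \<open>
  A product of quotient maps need not be a quotient map, so continuity is not inherited from that
  of the brackets. It is checked at each configuration separately, with the continuous choice of
  normal vectors near that configuration that \<open>project_onto_line\<close> provides.
\<close>

lemma continuous_map_cross_ratio:
  assumes n: "CARD('n::finite) \<ge> 2" and m: "m \<ge> CARD('n) + 2"
  shows "continuous_map (hyperplane_configurations m) euclidean
    (cross_ratio :: (nat \<Rightarrow> (complex ^ 'n) set set) \<Rightarrow> complex)"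
  unfolding continuous_map_atin limitin_canonical_iff
proof
  fix H :: "nat \<Rightarrow> (complex ^ 'n) set set"
  assume H: "H \<in> topspace (hyperplane_configurations m)"
  note nv = configuration_normal_vectors[OF H]
  define w where "w i = normal_vector (H i)" for i
  define P where "P K i = project_onto_line (w i) (normal_vector (K i))" for K :: "nat \<Rightarrow> (complex ^ 'n) set set" and i
  have lim: "((\<lambda>K. P K i) \<longlongrightarrow> w i) (atin (hyperplane_configurations m) H)" if "i < m" for i
  proof -
    have "continuous_map (hyperplane_configurations m) dual_projective_space (\<lambda>K. K i)"
      unfolding hyperplane_configurations_def
      using that by (intro continuous_map_from_subtopology continuous_map_product_projection) auto
    then have "continuous_map (hyperplane_configurations m) euclidean (\<lambda>K. P K i)"
      unfolding P_def using continuous_map_compose[OF _ continuous_map_project_onto_line] by (fastforce simp: o_def)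
    then have "((\<lambda>K. P K i) \<longlongrightarrow> P H i) (atin (hyperplane_configurations m) H)"
      using H unfolding continuous_map_atin limitin_canonical_iff by blast
    moreover have "P H i = w i" using project_onto_own_line nv(1)[OF that] by (simp add: P_def w_def)
    ultimately show ?thesis by simp
  qed
  have "((\<lambda>K. cross_ratio_vectors (P K)) \<longlongrightarrow> cross_ratio_vectors w) (atin (hyperplane_configurations m) H)"
    using n m nv(3) by (intro tendsto_cross_ratio_vectors lim bracket_nonzero[of m]) (auto simp: w_def)
  moreover have "\<forall>\<^sub>F K in atin (hyperplane_configurations m) H. cross_ratio_vectors (P K) = cross_ratio K"
  proof -
    have "\<forall>\<^sub>F K in atin (hyperplane_configurations m) H. \<forall>i\<in>{..<m}. P K i \<noteq> 0"
      using lim nv(1) by (auto simp: eventually_ball_finite_distrib w_def intro!: tendsto_imp_eventually_ne)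
    moreover have "\<forall>\<^sub>F K in atin (hyperplane_configurations m) H. K \<in> topspace (hyperplane_configurations m)"
      using H unfolding eventually_atin by (auto intro!: exI[of _ "topspace (hyperplane_configurations m)"])
    ultimately show ?thesis
    proof eventually_elim
      case (elim K)
      note nK = configuration_normal_vectors[OF elim(2)]
      have "P K i \<noteq> 0 \<and> K i = hyperplane (P K i)" if i: "i < CARD('n) + 2" for i
      proof -
        have "i < m" using i m by simp
        then have "P K i \<noteq> 0" using elim(1) by auto
        then have "hyperplane (P K i) = hyperplane (normal_vector (K i))"
          unfolding P_def project_onto_line_def by (intro hyperplane_scale) auto
        then show ?thesis using nK(2)[OF \<open>i < m\<close>] \<open>P K i \<noteq> 0\<close> by simp
      qed
      then show ?case using cross_ratio_hyperplanes[OF n, of "P K" K] by simp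
    qed
  qed
  ultimately show "(cross_ratio \<longlongrightarrow> cross_ratio H) (atin (hyperplane_configurations m) H)"
    using tendsto_cong unfolding cross_ratio_def w_def by fast
qed

lemma cross_ratio_orbit:
  fixes H H' :: "nat \<Rightarrow> (complex ^ 'n::finite) set set"
  assumes n: "CARD('n) \<ge> 2" and m: "m \<ge> CARD('n) + 2"
    and H: "H \<in> topspace (hyperplane_configurations m)" and H': "H' \<in> topspace (hyperplane_configurations m)"
    and orbit: "configuration_orbit m H = configuration_orbit m H'"
  shows "cross_ratio H' = cross_ratio H"
proof -
  have "H' = (\<lambda>i\<in>{..<m}. (\<lambda>p. (*v) (Finite_Cartesian_Product.mat 1) ` p) ` H' i)"
    using H' extensional_restrict[of H' "{..<m}"] by (simp add: topspace_hyperplane_configurations)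
  moreover have "(\<lambda>p. (*v) (Finite_Cartesian_Product.mat 1 :: complex ^ 'n ^ 'n) ` p) \<in> projective_automorphisms"
    unfolding projective_automorphisms_def
    by (intro CollectI exI[of _ "Finite_Cartesian_Product.mat 1"] conjI refl)
      (auto simp: invertible_def intro!: exI[of _ "Finite_Cartesian_Product.mat 1"])
  ultimately have "H' \<in> configuration_orbit m H'"
    unfolding configuration_orbit_def by blast
  then have "H' \<in> configuration_orbit m H" by (simp only: orbit)
  then obtain \<phi> where \<phi>: "\<phi> \<in> projective_automorphisms" "H' = (\<lambda>i\<in>{..<m}. \<phi> ` H i)"
    unfolding configuration_orbit_def by (elim CollectE exE conjE)
  then obtain A :: "complex ^ 'n ^ 'n" where "invertible A" "\<phi> = (\<lambda>p. (*v) A ` p)"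
    unfolding projective_automorphisms_def by (elim CollectE exE conjE)
  then have A: "invertible A" "H' = (\<lambda>i\<in>{..<m}. (\<lambda>p. (*v) A ` p) ` H i)"
    using \<phi>(2) by simp_all
  then obtain B where B: "A ** B = Finite_Cartesian_Product.mat 1" "B ** A = Finite_Cartesian_Product.mat 1" by (auto simp: invertible_def)
  have "invertible B" using B by (auto simp: invertible_def)
  then have det: "det B \<noteq> 0" by (simp add: invertible_det_nz)
  note nv = configuration_normal_vectors[OF H]
  have "a v* B = 0 \<Longrightarrow> a = 0" for a
  proof -
    have "a v* B v* A = a" using B by (simp add: vector_matrix_mul_assoc)
    then show "a v* B = 0 \<Longrightarrow> a = 0" by auto
  qed
  then have "normal_vector (H i) v* B \<noteq> 0 \<and> H' i = hyperplane (normal_vector (H i) v* B)"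
    if "i < CARD('n) + 2" for i
    using that m nv(1)[of i] nv(2)[of i] image_hyperplane[OF B, of "normal_vector (H i)"] A(2) by auto
  then have "cross_ratio H' = cross_ratio_vectors (\<lambda>i. normal_vector (H i) v* B)"
    by (rule cross_ratio_hyperplanes[OF n])
  then show ?thesis
    using cross_ratio_vectors_linear[OF det] by (simp add: cross_ratio_def)
qed

definition moduli_cross_ratio :: "nat \<Rightarrow> (nat \<Rightarrow> (complex ^ 'n::finite) set set) set \<Rightarrow> complex" where
  "moduli_cross_ratio m s =
     cross_ratio (SOME H. H \<in> topspace (hyperplane_configurations m) \<and> configuration_orbit m H = s)"

lemma moduli_cross_ratio_orbit:
  fixes H :: "nat \<Rightarrow> (complex ^ 'n::finite) set set"
  assumes "CARD('n) \<ge> 2" "m \<ge> CARD('n) + 2" "H \<in> topspace (hyperplane_configurations m)"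
  shows "moduli_cross_ratio m (configuration_orbit m H) = cross_ratio H"
proof -
  define K where "K = (SOME K. K \<in> topspace (hyperplane_configurations m) \<and>
    configuration_orbit m K = configuration_orbit m H)"
  have "K \<in> topspace (hyperplane_configurations m) \<and> configuration_orbit m K = configuration_orbit m H"
    unfolding K_def by (rule someI[where x = H]) (simp add: assms(3))
  then have "cross_ratio K = cross_ratio H"
    by (intro cross_ratio_orbit[OF assms(1,2,3)]) auto
  then show ?thesis by (simp only: moduli_cross_ratio_def K_def)
qed

lemma topspace_hyperplane_moduli:
  "topspace (hyperplane_moduli m) = configuration_orbit m ` topspace (hyperplane_configurations m)"
  by (simp add: hyperplane_moduli_def topspace_quotient_topology)

lemma continuous_map_configuration_orbit:
  "continuous_map (hyperplane_configurations m) (hyperplane_moduli m) (configuration_orbit m)"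
  unfolding hyperplane_moduli_def by (rule quotient_imp_continuous_map[OF quotient_map_quotient_topology])

theorem continuous_map_moduli_cross_ratio:
  assumes "CARD('n::finite) \<ge> 2" "m \<ge> CARD('n) + 2"
  shows "continuous_map (hyperplane_moduli m) (top_of_set (- {0, 1}))
    (moduli_cross_ratio m :: (nat \<Rightarrow> (complex ^ 'n) set set) set \<Rightarrow> complex)"
proof -
  have "continuous_map (hyperplane_configurations m) euclidean
      ((moduli_cross_ratio m :: (nat \<Rightarrow> (complex ^ 'n) set set) set \<Rightarrow> complex) \<circ> configuration_orbit m)"
    using continuous_map_cross_ratio[OF assms]
    by (rule continuous_map_eq) (simp add: moduli_cross_ratio_orbit[OF assms])
  then have "continuous_map (hyperplane_moduli m) euclidean
      (moduli_cross_ratio m :: (nat \<Rightarrow> (complex ^ 'n) set set) set \<Rightarrow> complex)"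
    unfolding hyperplane_moduli_def
    using continuous_compose_quotient_map_eq[OF quotient_map_quotient_topology] by blast
  moreover have "moduli_cross_ratio m s \<notin> {0, 1}"
    if s: "s \<in> topspace (hyperplane_moduli m)" for s :: "(nat \<Rightarrow> (complex ^ 'n) set set) set"
  proof -
    obtain H where H: "H \<in> topspace (hyperplane_configurations m)" "s = configuration_orbit m H"
      using s by (auto simp: topspace_hyperplane_moduli)
    then show ?thesis
      using cross_ratio_vectors_neq_01[OF assms configuration_normal_vectors(3)[OF H(1)]]
      by (simp add: moduli_cross_ratio_orbit[OF assms] cross_ratio_def)
  qed
  ultimately show ?thesis by (auto simp: continuous_map_in_subtopology)
qed

section \<open>Spaces over the twice-punctured plane\<close>

definition gap :: "nat \<Rightarrow> real set" where
  "gap k = (if k = 0 then {..<0} else if k = 1 then {0<..<1} else {1<..})"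

text \<open>
  The numbers \<open>0\<close> and \<open>1\<close> divide the real line into three intervals; only the \<open>k\<close>-th is a
  passage between the two half planes.
\<close>

definition slit_plane :: "nat \<Rightarrow> complex set" where
  "slit_plane k = {z. Im z \<noteq> 0 \<or> Re z \<in> gap k}"

lemma open_slit_plane: "open (slit_plane k)"
proof -
  have "open (gap k)" by (simp add: gap_def)
  then have "open (Im -` (- {0}) \<union> Re -` gap k)"
    by (intro open_Un open_vimage continuous_intros) auto
  moreover have "slit_plane k = Im -` (- {0}) \<union> Re -` gap k" by (auto simp: slit_plane_def)
  ultimately show ?thesis by simp
qed

lemma connected_slit_plane: "connected (slit_plane k)"
proof -
  have strip: "connected (Re -` gap k)"
    by (intro convex_connected convex_linear_vimage bounded_linear.linear[OF bounded_linear_Re])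
      (simp add: gap_def)
  have "(if k = 0 then - 1 else if k = 1 then 1 / 2 else 2) \<in> gap k" by (simp add: gap_def)
  then obtain r where r: "r \<in> gap k" by blast
  then have "Complex r 1 \<in> {z. 0 < Im z} \<inter> Re -` gap k" "Complex r (- 1) \<in> {z. Im z < 0} \<inter> Re -` gap k"
    by auto
  then have meet: "{z. 0 < Im z} \<inter> Re -` gap k \<noteq> {}" "{z. Im z < 0} \<inter> Re -` gap k \<noteq> {}"
    by blast+
  have "connected ({z. 0 < Im z} \<union> Re -` gap k)" "connected ({z. Im z < 0} \<union> Re -` gap k)"
    by (intro connected_Un strip connected_halfspace_Im_gt connected_halfspace_Im_lt meet)+
  then have "connected (({z. 0 < Im z} \<union> Re -` gap k) \<union> ({z. Im z < 0} \<union> Re -` gap k))"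
    by (rule connected_Un) (use meet(1) in blast)
  moreover have "slit_plane k = ({z. 0 < Im z} \<union> Re -` gap k) \<union> ({z. Im z < 0} \<union> Re -` gap k)"
    by (auto simp: slit_plane_def)
  ultimately show ?thesis by simp
qed

lemma slit_planes_cover: "z \<notin> {0, 1} \<Longrightarrow> \<exists>k\<in>{..2}. z \<in> slit_plane k"
  by (intro bexI[of _ "if Re z < 0 then 0 else if Re z < 1 then 1 else 2"])
    (auto simp: slit_plane_def gap_def complex_eq_iff)

lemma slit_planes_inter: "z \<in> slit_plane j \<Longrightarrow> z \<in> slit_plane k \<Longrightarrow> j \<in> {..2} \<Longrightarrow> k \<in> {..2} \<Longrightarrow> j \<noteq> k \<Longrightarrow> Im z \<noteq> 0"
  by (auto simp: slit_plane_def gap_def split: if_splits)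

text \<open>
  The frames of the flat bundle. They are locally constant off the real line; real points are
  counted with the upper half plane.
\<close>

definition half_plane_step :: "'g \<Rightarrow> 'g \<Rightarrow> complex \<Rightarrow> 'g" where
  "half_plane_step e g z = (if Im z \<ge> 0 then e else g)"

text \<open>
  Two different slit planes have no real point in common, so there the ratio of their frames is
  constant on either half plane.
\<close>

lemma flat_cocycle_over_punctured_plane:
  assumes G: "Group.group G" and f: "continuous_map X (top_of_set (- {0, 1})) f"
    and g: "\<And>k. k \<in> {..2} \<Longrightarrow> g k \<in> carrier G"
  shows "flat_cocycle G X {..2} (\<lambda>k. {x \<in> topspace X. f x \<in> slit_plane k})
    (\<lambda>k x. half_plane_step \<one>\<^bsub>G\<^esub> (g k) (f x))"
proof -
  interpret Group.group G by (rule G)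
  have f': "continuous_map X euclidean f" "\<And>x. x \<in> topspace X \<Longrightarrow> f x \<notin> {0, 1}"
    using f by (auto simp: continuous_map_in_subtopology)
  have open_pre: "openin X {x \<in> topspace X. f x \<in> W}" if "open W" for W
    using openin_continuous_map_preimage[OF f'(1), of W] that by simp
  show ?thesis
  proof (unfold_locales)
    show "openin X {x \<in> topspace X. f x \<in> slit_plane k}" for k
      by (rule open_pre[OF open_slit_plane])
    show "\<exists>k\<in>{..2}. x \<in> {x \<in> topspace X. f x \<in> slit_plane k}" if "x \<in> topspace X" for x
      using slit_planes_cover[OF f'(2)[OF that]] that by blast
    show "half_plane_step \<one>\<^bsub>G\<^esub> (g k) (f x) \<in> carrier G" if "k \<in> {..2}" for k x
      using g[OF that] by (simp add: half_plane_step_def)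
  next
    fix j k :: nat assume jk: "j \<in> {..2}" "k \<in> {..2}"
    define W where "W = {x \<in> topspace X. f x \<in> slit_plane j} \<inter> {x \<in> topspace X. f x \<in> slit_plane k}"
    define c where "c x = inv\<^bsub>G\<^esub> (half_plane_step \<one>\<^bsub>G\<^esub> (g j) (f x)) \<otimes>\<^bsub>G\<^esub> half_plane_step \<one>\<^bsub>G\<^esub> (g k) (f x)" for x
    have "continuous_map (subtopology X W) (discrete_topology (carrier G)) c"
    proof (cases "j = k")
      case True
      have "half_plane_step \<one>\<^bsub>G\<^esub> (g k) (f x) \<in> carrier G" for x
        using g[OF jk(2)] by (simp add: half_plane_step_def)
      then have "c = (\<lambda>_. \<one>\<^bsub>G\<^esub>)" by (simp add: fun_eq_iff c_def True)
      then show ?thesis by (simp add: continuous_map_const)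
    next
      case False
      have c: "c x = half_plane_step \<one>\<^bsub>G\<^esub> (inv\<^bsub>G\<^esub> (g j) \<otimes>\<^bsub>G\<^esub> g k) (f x)" for x
        using g[OF jk(1)] g[OF jk(2)] by (simp add: c_def half_plane_step_def)
      have c_carrier: "c x \<in> carrier G" for x
        using g[OF jk(1)] g[OF jk(2)] by (simp add: c half_plane_step_def)
      have Im: "Im (f x) \<noteq> 0" if "x \<in> W" for x
        using that slit_planes_inter[OF _ _ jk False] by (auto simp: W_def)
      show ?thesis
        unfolding continuous_map
      proof (intro conjI allI impI)
        show "c ` topspace (subtopology X W) \<subseteq> topspace (discrete_topology (carrier G))"
          using c_carrier by auto
        fix T
        define P where "P = (if \<one>\<^bsub>G\<^esub> \<in> T then {z. 0 < Im z} else {}) \<union>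
          (if inv\<^bsub>G\<^esub> (g j) \<otimes>\<^bsub>G\<^esub> g k \<in> T then {z. Im z < 0} else {})"
        have "open P" by (auto simp: P_def intro!: open_Un open_halfspace_Im_gt open_halfspace_Im_lt)
        then have "openin (subtopology X W) ({x \<in> topspace X. f x \<in> P} \<inter> W)"
          by (intro openin_subtopology_Int open_pre)
        moreover have "{x \<in> topspace (subtopology X W). c x \<in> T} = {x \<in> topspace X. f x \<in> P} \<inter> W"
        proof -
          have "c x \<in> T \<longleftrightarrow> f x \<in> P" if "x \<in> W" for x
            using Im[OF that] by (cases "0 < Im (f x)") (auto simp: c half_plane_step_def P_def)
          then show ?thesis by (auto simp: W_def)
        qed
        ultimately show "openin (subtopology X W) {x \<in> topspace (subtopology X W). c x \<in> T}"
          by simp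
      qed
    qed
    then show "continuous_map (subtopology X ({x \<in> topspace X. f x \<in> slit_plane j} \<inter> {x \<in> topspace X. f x \<in> slit_plane k}))
        (discrete_topology (carrier G))
        (\<lambda>x. inv\<^bsub>G\<^esub> (half_plane_step \<one>\<^bsub>G\<^esub> (g j) (f x)) \<otimes>\<^bsub>G\<^esub> half_plane_step \<one>\<^bsub>G\<^esub> (g k) (f x))"
      by (simp only: W_def c_def[abs_def])
  qed
qed

text \<open>
  Choose \<open>a\<close> in the upper and \<open>b\<close> in the lower half plane, both off \<open>S\<close>. A slit plane without
  \<open>S\<close> is path connected, and transport along a path inside it depends on the end points only. So
  going from the base point to \<open>a\<close>, to \<open>b\<close> through the \<open>k\<close>-th slit plane, back to \<open>a\<close> through the
  middle one and finally back to the base point has as holonomy a conjugate of the inverse of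
  \<open>g k\<close>, with the same conjugating element \<open>t\<close> for \<open>k = 0\<close> and \<open>k = 2\<close>.
\<close>

theorem large_fundamental_group_over_punctured_plane:
  fixes f :: "'a \<Rightarrow> complex"
  assumes f: "continuous_map X (top_of_set (- {0, 1})) f" and S: "countable S"
    and \<Psi>: "continuous_map (top_of_set (- S)) X \<Psi>" "\<And>z. z \<notin> S \<Longrightarrow> f (\<Psi> z) = z"
    and s: "f s \<notin> S" "\<Psi> (f s) = s"
  shows "large_group (fundamental_group X s)"
proof -
  define g where "g k = (if k = 0 then upper (- 1) else if k = 1 then 1\<^sub>m 2 else lower (- 1))" for k :: nat
  have g: "g k \<in> SL2" for k by (simp add: g_def one_mat2)
  define \<sigma> where "\<sigma> k = half_plane_step (1\<^sub>m 2) (g k)" for k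
  have \<sigma>: "\<sigma> k z \<in> SL2" for k z using g by (simp add: \<sigma>_def half_plane_step_def one_mat2)
  interpret flat_cocycle SL2_group X "{..2}" "\<lambda>k. {x \<in> topspace X. f x \<in> slit_plane k}" "\<lambda>k x. \<sigma> k (f x)"
    using flat_cocycle_over_punctured_plane[OF group_SL2 f, of g] g by (simp add: \<sigma>_def)
  have \<Psi>_top: "\<Psi> z \<in> topspace X" if "z \<notin> S" for z
    using \<Psi>(1) that by (auto simp: continuous_map_def)
  have s_top: "s \<in> topspace X" using \<Psi>_top[OF s(1)] s(2) by simp
  have lift: "\<exists>\<gamma>. pathin X \<gamma> \<and> \<gamma> 0 = \<Psi> p \<and> \<gamma> 1 = \<Psi> q \<and> transport \<gamma> 0 1 = \<sigma> k p * inv\<^bsub>SL2_group\<^esub> (\<sigma> k q)"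
    if k: "k \<in> {..2}" and pq: "p \<in> slit_plane k - S" "q \<in> slit_plane k - S" for k p q
  proof -
    have "path_connected (slit_plane k - S)"
      using S by (intro path_connected_open_diff_countable open_slit_plane connected_slit_plane) auto
    then obtain h where h: "path h" "path_image h \<subseteq> slit_plane k - S" "pathstart h = p" "pathfinish h = q"
      using pq unfolding path_connected_def by blast
    then have hS: "h t \<in> slit_plane k - S" if "t \<in> {0..1}" for t using that h(2) unfolding path_image_def by blast
    have "continuous_map (top_of_set {0..1}) (top_of_set (- S)) h"
      using h(1) hS by (auto simp: path_def continuous_map_in_subtopology)
    then have path: "continuous_map (top_of_set {0..1}) X (\<Psi> \<circ> h)"
      using \<Psi>(1) by (rule continuous_map_compose)
    have "transport (\<Psi> \<circ> h) 0 1 = \<sigma> k (f ((\<Psi> \<circ> h) 0)) \<otimes>\<^bsub>SL2_group\<^esub> inv\<^bsub>SL2_group\<^esub> (\<sigma> k (f ((\<Psi> \<circ> h) 1)))"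
      using hS \<Psi>_top \<Psi>(2) by (intro transport_in_chart[OF path _ k]) auto
    then have "transport (\<Psi> \<circ> h) 0 1 = \<sigma> k p * inv\<^bsub>SL2_group\<^esub> (\<sigma> k q)"
      using h(3,4) pq \<Psi>(2) by (simp add: pathstart_def pathfinish_def)
    then show ?thesis
      using path h(3,4) by (intro exI[of _ "\<Psi> \<circ> h"]) (auto simp: pathin_def pathstart_def pathfinish_def)
  qed
  obtain a where a: "0 < Im a" "a \<notin> S"
    using uncountable_halfspace_Im_gt[of 0] S by (metis (mono_tags) countable_subset mem_Collect_eq subsetI)
  obtain b where b: "Im b < 0" "b \<notin> S"
    using uncountable_halfspace_Im_lt[of 0] S by (metis (mono_tags) countable_subset mem_Collect_eq subsetI)
  have ab: "a \<in> slit_plane k - S" "b \<in> slit_plane k - S" "\<sigma> k a = 1\<^sub>m 2" "\<sigma> k b = g k" for k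
    using a b by (auto simp: slit_plane_def \<sigma>_def half_plane_step_def)
  have "f s \<notin> {0, 1}" using f s_top by (auto simp: continuous_map_in_subtopology)
  then obtain l where l: "l \<in> {..2}" "f s \<in> slit_plane l - S"
    using slit_planes_cover s(1) by blast
  define t where "t = \<sigma> l (f s)"
  define t' where "t' = inv\<^bsub>SL2_group\<^esub> t"
  have t: "t \<in> SL2" "t' \<in> SL2" "t * t' = 1\<^sub>m 2" "t' * t = 1\<^sub>m 2"
    using \<sigma>[of l "f s"] inv_closed[of t] r_inv[of t] l_inv[of t] by (auto simp: t_def t'_def)
  have inv_one: "inv\<^bsub>SL2_group\<^esub> (1\<^sub>m 2) = 1\<^sub>m 2" using inv_one by simp
  obtain \<delta> where \<delta>: "pathin X \<delta>" "\<delta> 0 = s" "\<delta> 1 = \<Psi> a" "transport \<delta> 0 1 = t"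
    using lift[OF l ab(1)] ab(3) inv_one s(2) SL2_carrier[OF t(1)] by (auto simp: t_def)
  obtain \<delta>' where \<delta>': "pathin X \<delta>'" "\<delta>' 0 = \<Psi> a" "\<delta>' 1 = s" "transport \<delta>' 0 1 = t'"
    using lift[OF l(1) ab(1) l(2)] ab(3) s(2) SL2_carrier[OF t(2)] by (auto simp: t_def t'_def)
  obtain \<beta> where \<beta>: "pathin X \<beta>" "\<beta> 0 = \<Psi> b" "\<beta> 1 = \<Psi> a" "transport \<beta> 0 1 = 1\<^sub>m 2"
    using lift[OF _ ab(2,1), of 1] ab(3,4)[of 1] inv_one by (auto simp: g_def)
  define D where "D = (\<lambda>\<gamma>. transport \<gamma> 0 1) ` loops X s"
  have generator: "t * inv\<^bsub>SL2_group\<^esub> (g k) * t' \<in> D" if k: "k \<in> {..2}" for k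
  proof -
    obtain \<gamma> where \<gamma>: "pathin X \<gamma>" "\<gamma> 0 = \<Psi> a" "\<gamma> 1 = \<Psi> b" "transport \<gamma> 0 1 = 1\<^sub>m 2 * inv\<^bsub>SL2_group\<^esub> (g k)"
      using lift[OF k ab(1,2)] ab(3,4)[of k] by auto
    have ends: "concat_loops u v 0 = u 0" "concat_loops u v 1 = v 1" for u v :: "real \<Rightarrow> 'a"
      by (simp_all add: concat_loops_def)
    define loop where "loop = concat_loops \<delta> (concat_loops \<gamma> (concat_loops \<beta> \<delta>'))"
    have p: "pathin X (concat_loops \<beta> \<delta>')" "pathin X (concat_loops \<gamma> (concat_loops \<beta> \<delta>'))" "pathin X loop"
      unfolding loop_def using \<delta> \<delta>' \<beta> \<gamma> by (auto intro!: pathin_concat simp: ends)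
    have "transport loop 0 1 = t * (1\<^sub>m 2 * inv\<^bsub>SL2_group\<^esub> (g k) * (1\<^sub>m 2 * t'))"
      unfolding loop_def using \<delta> \<delta>' \<beta> \<gamma> p by (simp add: transport_concat ends)
    also have "\<dots> = t * inv\<^bsub>SL2_group\<^esub> (g k) * t'"
    proof -
      have "inv\<^bsub>SL2_group\<^esub> (g k) \<in> SL2" using g[of k] inv_closed[of "g k"] by simp
      then show ?thesis
        using SL2_carrier t(1,2)
        by (simp add: assoc_mult_mat[of _ 2 2 _ 2 _ 2] mult_carrier_mat[of _ 2 2 _ 2] left_mult_one_mat[of _ 2 2])
    qed
    finally have "transport loop 0 1 = t * inv\<^bsub>SL2_group\<^esub> (g k) * t'" .
    moreover have "loop \<in> loops X s" using p(3) \<delta>(2) \<delta>'(3) by (simp add: loops_def loop_def ends)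
    ultimately show ?thesis
      unfolding D_def by (intro image_eqI[where x = loop]) (simp_all only:)
  qed
  have "zariski_topology 2 closure_of D = SL2"
  proof (rule zariski_dense_SL2[OF _ _ _ t])
    show "D \<subseteq> SL2"
      using transport_closed by (auto simp: D_def loops_def pathin_def)
    have "(\<lambda>_. s) \<in> loops X s" "transport (\<lambda>_. s) 0 1 = 1\<^sub>m 2"
      using s_top transport_constant[OF s_top, of 0 1] by (auto simp: loops_def pathin_def)
    then show "1\<^sub>m 2 \<in> D"
      unfolding D_def by (intro image_eqI[where x = "\<lambda>_. s"]) (simp_all only:)
    show "A * B \<in> D" if "A \<in> D" "B \<in> D" for A B
    proof -
      obtain u v where uv: "u \<in> loops X s" "A = transport u 0 1" "v \<in> loops X s" "B = transport v 0 1"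
        using \<open>A \<in> D\<close> \<open>B \<in> D\<close> by (auto simp: D_def)
      then have "pathin X u" "pathin X v" "u 1 = v 0" by (auto simp: loops_def)
      then have "A * B = transport (concat_loops u v) 0 1" "pathin X (concat_loops u v)"
        using uv transport_concat pathin_concat by auto
      moreover have "concat_loops u v \<in> loops X s"
        using uv calculation(2) by (auto simp: loops_def) (auto simp: concat_loops_def)
      ultimately show ?thesis unfolding D_def by (intro image_eqI[where x = "concat_loops u v"])
    qed
    show "t * upper 1 * t' \<in> D"
      using generator[of 0] SL2_group_inv[of 1 1 "- 1" 0] by (simp add: g_def del: mat2_mult)
    show "t * lower 1 * t' \<in> D"
      using generator[of 2] SL2_group_inv[of 1 1 0 "- 1"] by (simp add: g_def del: mat2_mult)
  qed
  then have "zariski_topology 2 closure_of (holonomy ` carrier (fundamental_group X s)) = SL2"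
    by (simp only: holonomy_image D_def)
  then show ?thesis
    unfolding large_group_def using semisimple_SL2 not_compact_SL2 holonomy_hom by blast
qed

section \<open>Moving one hyperplane in a pencil\<close>

text \<open>
  The normal vector number \<open>0\<close> is replaced by a vector \<open>v z\<close> in its span with number \<open>1\<close>, affine in
  \<open>z\<close>, with coefficients such that the cross ratio becomes \<open>z\<close>. General position fails if \<open>v z\<close>
  vanishes at the common point of \<open>CARD('n) - 1\<close> of the other hyperplanes; this excludes at most
  one \<open>z\<close> for each choice of these hyperplanes.
\<close>

theorem cross_ratio_section:
  fixes s :: "(nat \<Rightarrow> (complex ^ 'n::finite) set set) set"
  assumes n: "CARD('n) \<ge> 2" and m: "m \<ge> CARD('n) + 2" and s: "s \<in> topspace (hyperplane_moduli m)"
  obtains S and \<Psi> :: "complex \<Rightarrow> (nat \<Rightarrow> (complex ^ 'n) set set) set"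
  where "finite S" "moduli_cross_ratio m s \<notin> S" "\<Psi> (moduli_cross_ratio m s) = s"
    "continuous_map (top_of_set (- S)) (hyperplane_moduli m) \<Psi>"
    "\<And>z. z \<notin> S \<Longrightarrow> moduli_cross_ratio m (\<Psi> z) = z"
proof -
  obtain H where H: "H \<in> topspace (hyperplane_configurations m)" "s = configuration_orbit m H"
    using s by (auto simp: topspace_hyperplane_moduli)
  define a where "a i = normal_vector (H i)" for i
  note nv = configuration_normal_vectors[OF H(1), folded a_def]
  define z0 where "z0 = moduli_cross_ratio m s"
  have z0: "z0 = cross_ratio_vectors a"
    unfolding z0_def H(2) moduli_cross_ratio_orbit[OF n m H(1)] by (simp add: cross_ratio_def a_def[abs_def])
  have "z0 \<noteq> 1" unfolding z0 by (rule cross_ratio_vectors_neq_01(2)[OF n m nv(3)])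
  let ?r = "CARD('n)" and ?s = "CARD('n) + 1"
  have nz: "bracket a 0 ?r \<noteq> 0" "bracket a 0 ?s \<noteq> 0" "bracket a 1 ?r \<noteq> 0" "bracket a 1 ?s \<noteq> 0"
    by (rule bracket_nonzero[OF nv(3)]; use n m in simp)+
  \<comment> \<open>The affine parameter that is \<open>0\<close> for \<open>z = 1\<close>, where \<open>v z\<close> is a multiple of \<open>a 1\<close>, and \<open>1\<close> for \<open>z = z0\<close>, where it is a multiple of \<open>a 0\<close>.\<close>
  define t where "t z = (z - 1) / (z0 - 1)" for z
  \<comment> \<open>The denominators make the bracket of \<open>v z\<close> with number \<open>CARD('n) + 1\<close> equal to \<open>1\<close> for all \<open>z\<close>.\<close>
  define c where "c z = t z / bracket a 0 ?s" for z
  define d where "d z = (1 - t z) / bracket a 1 ?s" for z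
  define v where "v z = c z *s a 0 + d z *s a 1" for z
  define b where "b z = a(0 := v z)" for z
  have b0: "bracket (b z) 0 j = c z * bracket a 0 j + d z * bracket a 1 j" if "j \<noteq> 0" for z j
    unfolding b_def v_def bracket_update_linear[OF that]
    by (simp only: bracket_update_other[OF that] fun_upd_triv)
  have b1: "bracket (b z) 1 j = bracket a 1 j" if "j \<noteq> 0" for z j
    unfolding bracket_def b_def
    by (rule arg_cong[of _ _ det])
      (use that in \<open>auto simp: Finite_Cartesian_Product.vec_eq_iff row_index_def\<close>)
  have b0s: "bracket (b z) 0 ?s = 1" for z
    using nz by (simp add: b0 c_def d_def)
  have cross_b: "cross_ratio_vectors (b z) = z" for z
  proof -
    have "bracket a 0 ?r / bracket a 0 ?s = z0 * bracket a 1 ?r / bracket a 1 ?s"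
      using nz by (simp add: z0 cross_ratio_vectors_def)
    then have "bracket (b z) 0 ?r = (t z * z0 + (1 - t z)) * bracket a 1 ?r / bracket a 1 ?s"
      by (simp add: b0 c_def d_def ring_distribs add_divide_distrib flip: times_divide_eq_right)
    also have "t z * z0 + (1 - t z) = t z * (z0 - 1) + 1"
      by (simp add: algebra_simps)
    also have "\<dots> = z"
      using \<open>z0 \<noteq> 1\<close> by (simp add: t_def)
    finally show ?thesis
      using nz unfolding cross_ratio_vectors_def b0s by (simp add: b1[unfolded One_nat_def])
  qed
  have v_nz: "v z \<noteq> 0" for z
  proof
    assume "v z = 0"
    then have "bracket (b z) 0 ?s = bracket (a(0 := 0 *s a 0 + 0 *s a 0)) 0 ?s" by (simp add: b_def)
    also have "\<dots> = 0" by (subst bracket_update_linear) auto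
    finally show False using b0s by simp
  qed
  define S where "S = {z. \<not> general_position m (\<lambda>i. hyperplane (b z i))}"
  define Z where "Z K = {z. \<exists>x. x \<noteq> 0 \<and> pairing (v z) x = 0 \<and> (\<forall>i\<in>K. pairing (a i) x = 0)}" for K
  define \<K> where "\<K> = {K. K \<subseteq> {1..<m} \<and> card (insert 0 K) = ?r}"
  have gp: "x = 0" if "I \<subseteq> {..<m}" "card I = ?r" "\<And>i. i \<in> I \<Longrightarrow> pairing (a i) x = 0" for I x
    using nv(3) that unfolding general_position_hyperplanes by blast
  have S_subset: "S \<subseteq> (\<Union>K\<in>\<K>. Z K)"
  proof
    fix z assume "z \<in> S"
    then obtain I x where I: "I \<subseteq> {..<m}" "card I = ?r" "x \<noteq> 0" "\<And>i. i \<in> I \<Longrightarrow> pairing (b z i) x = 0"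
      unfolding S_def general_position_hyperplanes by blast
    have "0 \<in> I"
    proof (rule ccontr)
      assume "0 \<notin> I"
      then have "pairing (a i) x = 0" if "i \<in> I" for i
        using I(4)[OF that] that by (auto simp: b_def split: if_splits)
      then show False using gp[OF I(1,2)] I(3) by blast
    qed
    then have "card (insert 0 (I - {0})) = ?r" using I(2) by (simp add: insert_absorb)
    moreover have "I - {0} \<subseteq> {1..<m}" using I(1) by (auto simp: Suc_le_eq)
    ultimately have "I - {0} \<in> \<K>" by (simp add: \<K>_def)
    moreover have "pairing (v z) x = 0" using I(4)[OF \<open>0 \<in> I\<close>] by (simp add: b_def)
    moreover have "pairing (a i) x = 0" if "i \<in> I - {0}" for i
      using I(4)[of i] that by (simp add: b_def)
    then have "z \<in> Z (I - {0})"
      using I(3) calculation(2) unfolding Z_def by blast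
    ultimately show "z \<in> (\<Union>K\<in>\<K>. Z K)" by blast
  qed
  have unique: "z1 = z2" if K: "K \<in> \<K>" and z1: "z1 \<in> Z K" and z2: "z2 \<in> Z K" for K z1 z2
  proof -
    obtain x1 x2 where x: "x1 \<noteq> 0" "pairing (v z1) x1 = 0" "\<And>i. i \<in> K \<Longrightarrow> pairing (a i) x1 = 0"
        "x2 \<noteq> 0" "pairing (v z2) x2 = 0" "\<And>i. i \<in> K \<Longrightarrow> pairing (a i) x2 = 0"
      using z1 z2 unfolding Z_def by blast
    have K': "insert 0 K \<subseteq> {..<m}" "card (insert 0 K) = ?r" using K m by (auto simp: \<K>_def)
    have a0: "pairing (a 0) x1 \<noteq> 0" using gp[OF K', of x1] x(1,3) by auto
    \<comment> \<open>General position makes the common point of the hyperplanes in \<open>K\<close> unique, so \<open>x2\<close> is a multiple of \<open>x1\<close>.\<close>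
    define k where "k = pairing (a 0) x2 / pairing (a 0) x1"
    have "x2 - k *s x1 = 0"
      by (rule gp[OF K']) (use x a0 in \<open>auto simp: pairing_diff k_def\<close>)
    then have x2: "x2 = k *s x1" by simp
    then have "k \<noteq> 0" using x(4) by auto
    then have "pairing (v z2) x1 = 0" using x(5) by (simp add: x2)
    define \<alpha> where "\<alpha> = pairing (a 0) x1 / bracket a 0 ?s"
    define \<beta> where "\<beta> = pairing (a 1) x1 / bracket a 1 ?s"
    have pv: "pairing (v z) x1 = t z * (\<alpha> - \<beta>) + \<beta>" for z
    proof -
      have "pairing (v z) x1 = c z * pairing (a 0) x1 + d z * pairing (a 1) x1"
        by (simp only: v_def pairing_add pairing_scale)
      also have "\<dots> = t z * \<alpha> + (1 - t z) * \<beta>"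
        by (simp add: c_def d_def \<alpha>_def \<beta>_def)
      finally show ?thesis by (simp add: algebra_simps)
    qed
    have "\<alpha> \<noteq> 0" using a0 nz by (simp add: \<alpha>_def)
    then have "\<alpha> \<noteq> \<beta>" using x(2) pv[of z1] by auto
    moreover have "t z1 * (\<alpha> - \<beta>) = t z2 * (\<alpha> - \<beta>)"
      using x(2) \<open>pairing (v z2) x1 = 0\<close> unfolding pv by (simp add: add_eq_0_iff2)
    ultimately have "t z1 = t z2" by simp
    then show "z1 = z2" using \<open>z0 \<noteq> 1\<close> by (simp add: t_def)
  qed
  have "finite S"
  proof (rule finite_subset[OF S_subset], intro finite_UN_I)
    show "finite \<K>" by (rule finite_subset[of _ "Pow {1..<m}"]) (auto simp: \<K>_def)
    show "finite (Z K)" if K: "K \<in> \<K>" for K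
    proof (cases "Z K = {}")
      case False
      then obtain z where "z \<in> Z K" by blast
      then have "Z K \<subseteq> {z}" using unique[OF K] by blast
      then show ?thesis by (rule finite_subset) simp
    qed simp
  qed
  define Hz where "Hz z = (\<lambda>i\<in>{..<m}. hyperplane (b z i))" for z
  have Hz_top: "Hz z \<in> topspace (hyperplane_configurations m)" if "z \<notin> S" for z
  proof -
    have "b z i \<noteq> 0" if "i < m" for i using v_nz nv(1)[OF that] by (simp add: b_def)
    then have "hyperplane (b z i) \<in> topspace dual_projective_space" if "i < m" for i
      using that by (auto simp: topspace_dual_projective_space)
    moreover have "general_position m (Hz z)"
      using \<open>z \<notin> S\<close> general_position_cong[of m "Hz z" "\<lambda>i. hyperplane (b z i)"] by (auto simp: S_def Hz_def)
    ultimately show ?thesis by (auto simp: topspace_hyperplane_configurations Hz_def)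
  qed
  have Hz_cont: "continuous_map (top_of_set (- S)) (hyperplane_configurations m) Hz"
    unfolding hyperplane_configurations_def continuous_map_in_subtopology continuous_map_componentwise
  proof (intro conjI ballI)
    show "Hz ` topspace (top_of_set (- S)) \<subseteq> extensional {..<m}" by (auto simp: Hz_def)
    show "Hz \<in> topspace (top_of_set (- S)) \<rightarrow> {H. general_position m H}"
      using Hz_top by (auto simp: topspace_hyperplane_configurations)
    fix i assume i: "i \<in> {..<m}"
    have "continuous_on (- S) (\<lambda>z. b z i)"
    proof (cases "i = 0")
      case True
      have "continuous_on (- S) v"
        unfolding v_def c_def d_def t_def vector_scalar_mult_def
        using \<open>z0 \<noteq> 1\<close> nz by (intro continuous_intros) auto
      then show ?thesis using True by (simp add: b_def)
    qed (simp add: b_def)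
    then have "continuous_map (top_of_set (- S)) (top_of_set (- {0})) (\<lambda>z. b z i)"
      using v_nz nv(1) i by (auto simp: continuous_map_in_subtopology b_def)
    then have "continuous_map (top_of_set (- S)) dual_projective_space (hyperplane \<circ> (\<lambda>z. b z i))"
      using continuous_map_hyperplane by (rule continuous_map_compose)
    then show "continuous_map (top_of_set (- S)) dual_projective_space (\<lambda>z. Hz z i)"
      using i by (simp add: Hz_def o_def)
  qed
  define \<Psi> where "\<Psi> z = configuration_orbit m (Hz z)" for z
  have Hz_z0: "Hz z0 = H"
  proof
    fix i
    have "t z0 = 1" using \<open>z0 \<noteq> 1\<close> by (simp add: t_def)
    then have "v z0 = (1 / bracket a 0 ?s) *s a 0" by (simp add: v_def c_def d_def)
    then have "hyperplane (v z0) = hyperplane (a 0)" using nz by (simp add: hyperplane_scale)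
    then have "hyperplane (b z0 i) = hyperplane (a i)" by (simp add: b_def)
    then show "Hz z0 i = H i"
      using nv(2)[of i] H(1) by (auto simp: Hz_def topspace_hyperplane_configurations extensional_def)
  qed
  show thesis
  proof (rule that[of S \<Psi>])
    show "finite S" by fact
    have "general_position m (\<lambda>i. hyperplane (b z0 i))"
      using H(1) general_position_cong[of m "Hz z0" "\<lambda>i. hyperplane (b z0 i)"] Hz_z0
      by (auto simp: topspace_hyperplane_configurations Hz_def)
    then show "moduli_cross_ratio m s \<notin> S" by (simp add: S_def flip: z0_def)
    show "\<Psi> (moduli_cross_ratio m s) = s"
      unfolding z0_def[symmetric] \<Psi>_def Hz_z0 by (rule H(2)[symmetric])
    show "continuous_map (top_of_set (- S)) (hyperplane_moduli m) \<Psi>"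
      using continuous_map_compose[OF Hz_cont continuous_map_configuration_orbit]
      by (simp add: o_def \<Psi>_def[abs_def])
    show "moduli_cross_ratio m (\<Psi> z) = z" if "z \<notin> S" for z
    proof -
      have "b z i \<noteq> 0 \<and> Hz z i = hyperplane (b z i)" if "i < CARD('n) + 2" for i
        using that m v_nz nv(1)[of i] by (simp add: b_def Hz_def)
      then have "cross_ratio (Hz z) = z"
        using cross_ratio_hyperplanes[OF n, of "b z" "Hz z"] cross_b by simp
      then show ?thesis by (simp add: \<Psi>_def moduli_cross_ratio_orbit[OF n m Hz_top[OF \<open>z \<notin> S\<close>]])
    qed
  qed
qed

theorem corollary1p5:
  fixes n m :: nat
    and s :: "(nat \<Rightarrow> (complex ^ 'n::finite) set set) set"
  assumes "CARD('n) = n + 1"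
    and "n \<ge> 1"
    and "m \<ge> n + 3"
    and "s \<in> topspace (hyperplane_moduli m)"
  shows "large_group (fundamental_group (hyperplane_moduli m) s)"
proof -
  have n: "CARD('n) \<ge> 2" and m: "m \<ge> CARD('n) + 2" using assms(1-3) by simp_all
  show ?thesis
  proof (rule cross_ratio_section[OF n m assms(4)])
    fix S and \<Psi> :: "complex \<Rightarrow> (nat \<Rightarrow> (complex ^ 'n) set set) set"
    assume "finite S" "moduli_cross_ratio m s \<notin> S" "\<Psi> (moduli_cross_ratio m s) = s"
      "continuous_map (top_of_set (- S)) (hyperplane_moduli m) \<Psi>"
      "\<And>z. z \<notin> S \<Longrightarrow> moduli_cross_ratio m (\<Psi> z) = z"
    then show ?thesis
      using large_fundamental_group_over_punctured_plane[OF continuous_map_moduli_cross_ratio[OF n m], of S \<Psi> s]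
      by (simp add: countable_finite)
  qed
qed

end
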